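(* Let $G=(V,E)$ be a graph. Then $\mathrm{rank}(G)=n$ if and only if $E$ is an independent set in $\mathcal{A}(n-1)$ and is not an independent set in $\mathcal{A}(n-2)$.
   Context: $G$ is a simple undirected graph with $V=[m]$. $Sym(m,n)$ is the set of symmetric $m\times m$ matrices of rank at most $n$; $\phi_G(\Sigma)=(\sigma_{ii})_{i\in V}\oplus(\sigma_{ij})_{ij\in E}$; $\mathrm{rank}(G)$ is the smallest $n$ with $\dim\phi_G(Sym(m,n))=\#V+\#E$. The generic rigidity matroid $\mathcal{A}(d)$: for a $d\times m$ matrix $P$ of algebraically independent indeterminates with columns $\mathbf{p}_1,\dots,\mathbf{p}_m$, let $f_{ij}=\|\mathbf{p}_i-\mathbf{p}_j\|_2^2$; $\mathcal{A}(d)$ is the algebraic matroid on these polynomials, and $E$ is independent in $\mathcal{A}(d)$ iff $\{f_{ij}:ij\in E\}$ is algebraically independent over $\mathbb{R}$. *)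

theory Defs
  imports "HOL-Analysis.Analysis" "HOL-Library.Poly_Mapping"
begin

subsection \<open>Polynomials over the reals in variables of type \<open>'x\<close>\<close>

type_synonym 'x rpoly = "('x \<Rightarrow>\<^sub>0 nat) \<Rightarrow>\<^sub>0 real"

definition rConst :: "real \<Rightarrow> 'x rpoly" where
  "rConst c = Poly_Mapping.single 0 c"

definition rVar :: "'x \<Rightarrow> 'x rpoly" where
  "rVar x = Poly_Mapping.single (Poly_Mapping.single x 1) 1"

definition rvars :: "'x rpoly \<Rightarrow> 'x set" where
  "rvars Q = (\<Union>m\<in>Poly_Mapping.keys Q. Poly_Mapping.keys m)"

text \<open>Substitution of \<open>a x\<close> for each variable \<open>x\<close>, where \<open>c\<close> embeds the coefficients into the
  target ring: \<open>c = id\<close> evaluates at a real point, \<open>c = rConst\<close> substitutes polynomials.\<close>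

definition rsubst :: "(real \<Rightarrow> 'a::comm_ring_1) \<Rightarrow> ('x \<Rightarrow> 'a) \<Rightarrow> 'x rpoly \<Rightarrow> 'a" where
  "rsubst c a Q = (\<Sum>m\<in>Poly_Mapping.keys Q. c (Poly_Mapping.lookup Q m) *
     (\<Prod>x\<in>Poly_Mapping.keys m. a x ^ Poly_Mapping.lookup m x))"

definition alg_independent :: "'e set \<Rightarrow> ('e \<Rightarrow> 'x rpoly) \<Rightarrow> bool" where
  "alg_independent E f \<longleftrightarrow> (\<forall>Q. rvars Q \<subseteq> E \<longrightarrow> rsubst rConst f Q = 0 \<longrightarrow> Q = 0)"


subsection \<open>Dimension of subsets of a real affine space\<close>

text \<open>The affine space with coordinates indexed by \<open>I\<close> is \<open>I \<rightarrow>\<^sub>E UNIV\<close>. The dimension of a subset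
  is the Krull dimension of its Zariski closure (the empty set, which has no chains, gets the
  value 0).\<close>

definition zariski_closed :: "'c set \<Rightarrow> ('c \<Rightarrow> real) set \<Rightarrow> bool" where
  "zariski_closed I Z \<longleftrightarrow> (\<exists>S. (\<forall>p\<in>S. rvars p \<subseteq> I) \<and>
     Z = {x \<in> I \<rightarrow>\<^sub>E UNIV. \<forall>p\<in>S. rsubst id x p = 0})"

definition zariski_closure :: "'c set \<Rightarrow> ('c \<Rightarrow> real) set \<Rightarrow> ('c \<Rightarrow> real) set" where
  "zariski_closure I X = \<Inter>{Z. zariski_closed I Z \<and> X \<subseteq> Z}"

definition zariski_irreducible :: "'c set \<Rightarrow> ('c \<Rightarrow> real) set \<Rightarrow> bool" where
  "zariski_irreducible I Z \<longleftrightarrow> zariski_closed I Z \<and> Z \<noteq> {} \<and>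
     (\<forall>A B. zariski_closed I A \<longrightarrow> zariski_closed I B \<longrightarrow> Z = A \<union> B \<longrightarrow> Z = A \<or> Z = B)"

definition zariski_dim :: "'c set \<Rightarrow> ('c \<Rightarrow> real) set \<Rightarrow> enat" where
  "zariski_dim I X = Sup {enat k | k. \<exists>C :: nat \<Rightarrow> ('c \<Rightarrow> real) set.
     (\<forall>i\<le>k. zariski_irreducible I (C i) \<and> C i \<subseteq> zariski_closure I X) \<and>
     (\<forall>i<k. C i \<subset> C (Suc i))}"


subsection \<open>Simple graphs and the rank of a graph\<close>

text \<open>The vertex set \<open>[m]\<close> is a finite type \<open>'v\<close> with \<open>m = CARD('v)\<close>. A simple undirected graph is
  given by its edge set, a set of two-element sets of vertices.\<close>

definition complete_edges :: "'v set set" where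
  "complete_edges = {e. card e = 2}"

text \<open>The value of a symmetric function of two vertices on an unordered pair.\<close>

definition on_edge :: "('v \<Rightarrow> 'v \<Rightarrow> 'a) \<Rightarrow> 'v set \<Rightarrow> 'a" where
  "on_edge h e = (THE a. \<exists>i j. e = {i, j} \<and> a = h i j)"

lemma on_edge_doubleton:
  assumes "h i j = h j i"
  shows "on_edge h {i, j} = h i j"
  unfolding on_edge_def using assms by (intro the_equality) (auto simp: doubleton_eq_iff)

definition sym_rank_le :: "nat \<Rightarrow> (real ^ 'v ^ 'v) set" where
  "sym_rank_le n = {\<Sigma>. transpose \<Sigma> = \<Sigma> \<and> rank \<Sigma> \<le> n}"

definition graph_coords :: "'v set set \<Rightarrow> ('v + 'v set) set" where
  "graph_coords E = UNIV <+> E"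

definition graph_proj :: "'v set set \<Rightarrow> real ^ 'v ^ 'v \<Rightarrow> ('v + 'v set \<Rightarrow> real)" where
  "graph_proj E \<Sigma> = restrict
     (case_sum (\<lambda>i. \<Sigma> $ i $ i) (on_edge (\<lambda>i j. \<Sigma> $ i $ j))) (graph_coords E)"

definition graph_rank :: "'v::finite set set \<Rightarrow> nat" where
  "graph_rank E = (LEAST n.
     zariski_dim (graph_coords E) (graph_proj E ` sym_rank_le n) = enat (CARD('v) + card E))"


subsection \<open>The generic rigidity matroid\<close>

text \<open>The entry of the generic \<open>d \<times> m\<close> matrix in row \<open>k < d\<close> and column \<open>i\<close> is the variable
  \<open>(k, i)\<close>.\<close>

definition sq_dist_poly :: "nat \<Rightarrow> 'v \<Rightarrow> 'v \<Rightarrow> (nat \<times> 'v) rpoly" where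
  "sq_dist_poly d i j = (\<Sum>k<d. (rVar (k, i) - rVar (k, j)) ^ 2)"

text \<open>The family of independent sets of the generic rigidity matroid. For \<open>d = 0\<close> all the
  polynomials are zero, so only the empty set is independent. For negative \<open>d\<close> there is no such
  matroid, hence no set is independent in it.\<close>

definition rigidity_indep_sets :: "int \<Rightarrow> 'v set set set" where
  "rigidity_indep_sets d =
     {E. 0 \<le> d \<and> E \<subseteq> complete_edges \<and> alg_independent E (on_edge (sq_dist_poly (nat d)))}"

end

theory Submission
  imports Defs "HOL-Computational_Algebra.Polynomial"
begin

text \<open>
  The image of \<open>\<phi>\<^sub>G\<close> has full dimension iff it is Zariski dense: every chain of irreducible closed
  subsets of an \<open>N\<close>-dimensional affine space has length at most \<open>N\<close>, because functions separating
  its consecutive members are algebraically independent, and there cannot be more than \<open>N\<close> of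
  those. Matrices of rank at most \<open>n\<close> may be replaced by Gram matrices of vectors
  \<open>p\<^sub>1, \<dots>, p\<^sub>m\<close> in \<open>\<real>\<^sup>n\<close>, so density means algebraic independence of the polynomials
  \<open>p\<^sub>i \<bullet> p\<^sub>i\<close> and \<open>p\<^sub>i \<bullet> p\<^sub>j\<close> for edges \<open>ij\<close>. By the Jacobian criterion, this independence and that of
  the squared distances in \<open>\<real>\<^sup>n\<^sup>-\<^sup>1\<close> are both decided by linear relations between gradients at a
  generic point, and for \<open>p\<^sub>i = \<lambda>\<^sub>i (q\<^sub>i, 1)\<close> the relations at \<open>p\<close> correspond to those at \<open>q\<close>.
\<close>

section \<open>Linear systems and polynomial functions\<close>

text \<open>A real symmetric matrix of rank at most n is a Gram matrix of vectors in \<real>^n only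
  if it is positive semidefinite. Gram matrices are enough nevertheless, because density tests
  polynomial identities only, and these spread from a short piece of a line to the whole line. Nor
  are points with algebraically independent coordinates used: "generic" means that finitely many
  prescribed nonzero polynomials do not vanish. The shift from n to n - 1 comes from homogeneous
  coordinates: writing p_i as \<lambda>_i (q_i, 1) uses up one coordinate, and the diagonal entries
  account for the m scaling factors. This needs the last coordinate of every p_i to be nonzero, so
  the passage from independence to gradients has to deliver a point that also avoids a given
  hypersurface. In the opposite direction a single point with independent gradients suffices, and an
  explicit one is built.\<close>

lemma homogeneous_system_nontrivial_solution:
  fixes c :: "'a \<Rightarrow> 'b \<Rightarrow> real"
  assumes "finite B" "finite A" "card B < card A"
  shows "\<exists>z. (\<exists>a\<in>A. z a \<noteq> 0) \<and> (\<forall>b\<in>B. (\<Sum>a\<in>A. c a b * z a) = 0)"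
  using assms
proof (induction B arbitrary: A c rule: finite_induct)
  case empty
  then have "A \<noteq> {}" by auto
  then show ?case by (intro exI[of _ "\<lambda>_. 1"]) auto
next
  case (insert b B)
  show ?case
  proof (cases "\<forall>a\<in>A. c a b = 0")
    case True
    from insert.IH[of A c] insert.prems insert.hyps obtain z where
      "\<exists>a\<in>A. z a \<noteq> 0" "\<forall>b\<in>B. (\<Sum>a\<in>A. c a b * z a) = 0" by auto
    then show ?thesis using True by (intro exI[of _ z]) auto
  next
    case False
    then obtain a0 where a0: "a0 \<in> A" "c a0 b \<noteq> 0" by auto
    define A' where "A' = A - {a0}"
    have A': "finite A'" "a0 \<notin> A'" "A = insert a0 A'" using insert.prems a0 by (auto simp: A'_def)
    then have "card B < card A'" using insert by simp
    \<comment> \<open>Gaussian elimination: equation \<open>b\<close> is solved for the unknown at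
      \<open>a0\<close>, and these are the coefficients of the other equations after substitution.
      Below, \<open>z'\<close> is obtained by back substitution.\<close>
    from insert.IH[OF A'(1) this, of "\<lambda>a x. c a x - c a b * c a0 x / c a0 b"] obtain z where
      z: "\<exists>a\<in>A'. z a \<noteq> 0" "\<And>x. x \<in> B \<Longrightarrow> (\<Sum>a\<in>A'. (c a x - c a b * c a0 x / c a0 b) * z a) = 0"
      by auto
    define S where "S = (\<Sum>a\<in>A'. c a b * z a)"
    define z' where "z' = z(a0 := - S / c a0 b)"
    have eq: "(\<Sum>a\<in>A. c a x * z' a) = (\<Sum>a\<in>A'. c a x * z a) - c a0 x * S / c a0 b" for x
    proof -
      have "(\<Sum>a\<in>A'. c a x * z' a) = (\<Sum>a\<in>A'. c a x * z a)"
        using A' by (intro sum.cong) (auto simp: z'_def)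
      then show ?thesis using A' by (simp add: z'_def)
    qed
    have "(\<Sum>a\<in>A. c a x * z' a) = 0" if "x \<in> insert b B" for x
    proof (cases "x = b")
      case True
      then show ?thesis unfolding eq using a0 by (simp add: S_def)
    next
      case False
      then have "(\<Sum>a\<in>A'. c a x * z a - (c a0 x / c a0 b) * (c a b * z a)) = 0"
        using z(2)[of x] that by (simp add: algebra_simps)
      then show ?thesis unfolding eq S_def
        by (simp add: sum_subtractf sum_distrib_left sum_divide_distrib)
    qed
    moreover have "\<exists>a\<in>A. z' a \<noteq> 0" using z(1) A' by (auto simp: z'_def)
    ultimately show ?thesis by blast
  qed
qed

text \<open>If \<open>w b\<close> were nonzero, row \<open>b\<close> would be a combination of the
  other rows. These are fewer than \<open>card A\<close> equations, so they have a nontrivial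
  solution, which then solves row \<open>b\<close> too and lies in the kernel.\<close>

lemma trivial_left_kernel:
  fixes c :: "'a \<Rightarrow> 'b \<Rightarrow> real"
  assumes "finite A" "finite B" "card B \<le> card A"
    and ker: "\<And>z. (\<And>b. b \<in> B \<Longrightarrow> (\<Sum>a\<in>A. c a b * z a) = 0) \<Longrightarrow> \<forall>a\<in>A. z a = 0"
    and w: "\<And>a. a \<in> A \<Longrightarrow> (\<Sum>b\<in>B. w b * c a b) = 0"
    and "b \<in> B"
  shows "w b = 0"
proof (rule ccontr)
  assume "w b \<noteq> 0"
  have "card (B - {b}) < card A"
    using assms(2,3) \<open>b \<in> B\<close> by (metis card_Diff1_less order_less_le_trans)
  from homogeneous_system_nontrivial_solution[OF _ assms(1) this, of c] assms(2)
  obtain z where z: "\<exists>a\<in>A. z a \<noteq> 0" "\<And>x. x \<in> B - {b} \<Longrightarrow> (\<Sum>a\<in>A. c a x * z a) = 0"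
    by auto
  have "0 = (\<Sum>a\<in>A. (\<Sum>x\<in>B. w x * c a x) * z a)" using w by simp
  also have "\<dots> = (\<Sum>x\<in>B. w x * (\<Sum>a\<in>A. c a x * z a))"
    unfolding sum_distrib_left sum_distrib_right by (subst sum.swap) (simp add: mult_ac)
  also have "\<dots> = w b * (\<Sum>a\<in>A. c a b * z a)"
    using z(2) by (subst sum.remove[OF \<open>finite B\<close> \<open>b \<in> B\<close>]) simp
  finally have "(\<Sum>a\<in>A. c a b * z a) = 0" using \<open>w b \<noteq> 0\<close> by simp
  then have "\<forall>a\<in>A. z a = 0" using z(2) by (intro ker) (metis Diff_iff singletonD)
  then show False using z(1) by auto
qed

text \<open>\<open>D\<close> is only an upper bound for the total degree, so constants live at every
  \<open>D\<close>. The sole multiplicative rule is by a variable, which keeps inductions short;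
  general products are derived. The bound serves to count monomials and to choose relations of least
  degree.\<close>

inductive poly_fun :: "'x set \<Rightarrow> nat \<Rightarrow> (('x \<Rightarrow> real) \<Rightarrow> real) \<Rightarrow> bool" for I where
  const: "poly_fun I D (\<lambda>_. c)"
| add: "poly_fun I D F \<Longrightarrow> poly_fun I D G \<Longrightarrow> poly_fun I D (\<lambda>x. F x + G x)"
| var_mult: "i \<in> I \<Longrightarrow> poly_fun I D F \<Longrightarrow> poly_fun I (Suc D) (\<lambda>x. x i * F x)"

lemma poly_fun_Suc: "poly_fun I D F \<Longrightarrow> poly_fun I (Suc D) F"
  by (induction rule: poly_fun.induct) (auto intro: poly_fun.intros)

lemma poly_fun_mono: "poly_fun I D F \<Longrightarrow> D \<le> D' \<Longrightarrow> poly_fun I D' F"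
  by (induction D' rule: nat_induct) (auto simp: le_Suc_eq intro: poly_fun_Suc)

lemma poly_fun_var: "i \<in> I \<Longrightarrow> poly_fun I 1 (\<lambda>x. x i)"
  using poly_fun.var_mult[OF _ poly_fun.const[of I 0 1], of i] by simp

lemma poly_fun_mult:
  "poly_fun I D F \<Longrightarrow> poly_fun I D' G \<Longrightarrow> poly_fun I (D + D') (\<lambda>x. F x * G x)"
proof (induction rule: poly_fun.induct)
  case (const D c)
  from this have "poly_fun I D' (\<lambda>x. c * G x)"
    by (induction rule: poly_fun.induct)
      (auto simp: distrib_left mult.left_commute[of c] intro: poly_fun.intros)
  then show ?case by (rule poly_fun_mono) simp
qed (auto simp: distrib_right mult.assoc intro: poly_fun.intros)

lemma poly_fun_power: "poly_fun I D F \<Longrightarrow> poly_fun I (k * D) (\<lambda>x. F x ^ k)"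
  by (induction k) (auto intro: poly_fun.const poly_fun_mult)

lemma poly_fun_prod:
  "(\<And>a. a \<in> A \<Longrightarrow> poly_fun I D (F a)) \<Longrightarrow> poly_fun I (card A * D) (\<lambda>x. \<Prod>a\<in>A. F a x)"
  by (induction A rule: infinite_finite_induct) (auto intro: poly_fun.intros poly_fun_mult)

lemma poly_fun_compose:
  assumes "poly_fun A D F" "\<And>a. a \<in> A \<Longrightarrow> poly_fun I M (g a)"
  shows "poly_fun I (D * M) (\<lambda>x. F (\<lambda>a. g a x))"
  using assms by (induction rule: poly_fun.induct) (auto intro: poly_fun.intros poly_fun_mult)

lemma poly_fun_cong:
  assumes "poly_fun I D F" "\<And>i. i \<in> I \<Longrightarrow> x i = y i"
  shows "F x = F y"
  using assms by (induction rule: poly_fun.induct) auto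

lemma poly_fun_line:
  assumes "poly_fun I D F"
  shows "\<exists>p. \<forall>t. F (\<lambda>i. x i + t * v i) = poly p t"
  using assms
proof (induction rule: poly_fun.induct)
  case (const D c)
  then show ?case by (intro exI[of _ "[:c:]"]) simp
next
  case (add D F G)
  then show ?case by (metis poly_add)
next
  case (var_mult i D F)
  then obtain p where "\<forall>t. F (\<lambda>i. x i + t * v i) = poly p t" by auto
  then show ?case by (intro exI[of _ "[:x i, v i:] * p"]) (simp add: algebra_simps)
qed

definition polynomial_on :: "'x set \<Rightarrow> (('x \<Rightarrow> real) \<Rightarrow> real) \<Rightarrow> bool" where
  "polynomial_on I F \<longleftrightarrow> (\<exists>D. poly_fun I D F)"

lemma polynomial_on_const: "polynomial_on I (\<lambda>_. c)"
  and polynomial_on_var: "i \<in> I \<Longrightarrow> polynomial_on I (\<lambda>x. x i)"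
  unfolding polynomial_on_def by (blast intro: poly_fun.const poly_fun_var)+

lemma polynomial_on_add:
  "polynomial_on I F \<Longrightarrow> polynomial_on I G \<Longrightarrow> polynomial_on I (\<lambda>x. F x + G x)"
  unfolding polynomial_on_def
  by (metis poly_fun.add poly_fun_mono nat_le_linear)

lemma polynomial_on_mult:
  "polynomial_on I F \<Longrightarrow> polynomial_on I G \<Longrightarrow> polynomial_on I (\<lambda>x. F x * G x)"
  unfolding polynomial_on_def by (blast intro: poly_fun_mult)

lemma polynomial_on_diff:
  "polynomial_on I F \<Longrightarrow> polynomial_on I G \<Longrightarrow> polynomial_on I (\<lambda>x. F x - G x)"
  using polynomial_on_add[OF _ polynomial_on_mult[OF polynomial_on_const[of I "-1"]], of F G]
  by simp

lemma polynomial_on_power: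
  "polynomial_on I F \<Longrightarrow> polynomial_on I (\<lambda>x. F x ^ k)"
  unfolding polynomial_on_def by (blast intro: poly_fun_power)

lemma polynomial_on_sum:
  "(\<And>a. a \<in> A \<Longrightarrow> polynomial_on I (F a)) \<Longrightarrow> polynomial_on I (\<lambda>x. \<Sum>a\<in>A. F a x)"
  by (induction A rule: infinite_finite_induct)
    (auto intro: polynomial_on_const polynomial_on_add)

lemma polynomial_on_prod:
  "(\<And>a. a \<in> A \<Longrightarrow> polynomial_on I (F a)) \<Longrightarrow> polynomial_on I (\<lambda>x. \<Prod>a\<in>A. F a x)"
  by (induction A rule: infinite_finite_induct)
    (auto intro: polynomial_on_const polynomial_on_mult)

lemma polynomial_on_cong:
  "polynomial_on I F \<Longrightarrow> (\<And>i. i \<in> I \<Longrightarrow> x i = y i) \<Longrightarrow> F x = F y"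
  unfolding polynomial_on_def by (blast dest: poly_fun_cong)

lemma polynomial_on_line:
  "polynomial_on I F \<Longrightarrow> \<exists>p. \<forall>t. F (\<lambda>i. x i + t * v i) = poly p t"
  unfolding polynomial_on_def by (blast intro: poly_fun_line)

lemma poly_fun_common_degree:
  assumes "finite A" "\<And>a. a \<in> A \<Longrightarrow> polynomial_on I (g a)"
  obtains M where "\<And>a. a \<in> A \<Longrightarrow> poly_fun I M (g a)"
proof -
  obtain d where d: "\<And>a. a \<in> A \<Longrightarrow> poly_fun I (d a) (g a)"
    using assms(2) unfolding polynomial_on_def by metis
  have "poly_fun I (\<Sum>a\<in>A. d a) (g a)" if "a \<in> A" for a
    using d[OF that] by (rule poly_fun_mono) (simp add: assms(1) member_le_sum that)
  then show ?thesis using that by blast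
qed

lemma polynomial_on_compose:
  assumes "polynomial_on A F" "finite A" "\<And>a. a \<in> A \<Longrightarrow> polynomial_on I (g a)"
  shows "polynomial_on I (\<lambda>x. F (\<lambda>a. g a x))"
  by (metis assms poly_fun_common_degree poly_fun_compose polynomial_on_def)

text \<open>On the line through \<open>x\<close> and \<open>y\<close> both functions are univariate
  polynomials, nonzero because of \<open>t = 0\<close> and \<open>t = 1\<close>, and their product
  has finitely many roots. The point is given explicitly because it must stay in every linear
  subspace containing \<open>x\<close> and \<open>y\<close>.\<close>

lemma polynomial_on_common_nonzero_on_line:
  assumes "polynomial_on I F" "polynomial_on I G" "F x \<noteq> 0" "G y \<noteq> 0"
  obtains t where "F (\<lambda>i. x i + t * (y i - x i)) \<noteq> 0" "G (\<lambda>i. x i + t * (y i - x i)) \<noteq> 0"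
proof -
  obtain p q where p: "\<And>t. F (\<lambda>i. x i + t * (y i - x i)) = poly p t"
    and q: "\<And>t. G (\<lambda>i. x i + t * (y i - x i)) = poly q t"
    using polynomial_on_line[OF assms(1), of x "\<lambda>i. y i - x i"]
      polynomial_on_line[OF assms(2), of x "\<lambda>i. y i - x i"] by metis
  have "p \<noteq> 0" "q \<noteq> 0" using p[of 0] q[of 1] assms(3,4) by auto
  then have "finite {t. poly (p * q) t = 0}" by (intro poly_roots_finite) simp
  then obtain t where "poly (p * q) t \<noteq> 0"
    using infinite_UNIV_char_0[where 'a = real] by (metis (mono_tags, lifting) UNIV_eq_I mem_Collect_eq)
  then show ?thesis using that p q by auto
qed

lemma polynomial_on_common_nonzero:
  assumes "finite A" "\<And>a. a \<in> A \<Longrightarrow> polynomial_on I (F a)" "\<And>a. a \<in> A \<Longrightarrow> \<exists>x. F a x \<noteq> 0"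
  shows "\<exists>x. \<forall>a\<in>A. F a x \<noteq> 0"
  using assms
proof (induction A rule: finite_induct)
  case (insert a A)
  then obtain x where "\<forall>a\<in>A. F a x \<noteq> 0" by auto
  then have x: "(\<Prod>a\<in>A. F a x) \<noteq> 0" using insert.hyps by auto
  obtain y where y: "F a y \<noteq> 0" using insert.prems by auto
  have "polynomial_on I (\<lambda>x. \<Prod>a\<in>A. F a x)" "polynomial_on I (F a)"
    using insert by (auto intro: polynomial_on_prod)
  then obtain t where "(\<Prod>a\<in>A. F a (\<lambda>i. x i + t * (y i - x i))) \<noteq> 0"
      "F a (\<lambda>i. x i + t * (y i - x i)) \<noteq> 0"
    using x y polynomial_on_common_nonzero_on_line[of I "\<lambda>x. \<Prod>a\<in>A. F a x" "F a" x y] by blast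
  then show ?case using insert.hyps by auto
qed auto

section \<open>Linear independence of monomials as functions\<close>

lemma sum_monomials_insert:
  fixes z :: "('a \<Rightarrow> nat) \<Rightarrow> real"
  assumes "finite A" "a \<notin> A"
  shows "(\<Sum>b\<in>PiE (insert a A) (\<lambda>_. {..D}). z b * (\<Prod>i\<in>insert a A. y i ^ b i)) =
    (\<Sum>k\<le>D. (\<Sum>b\<in>PiE A (\<lambda>_. {..D}). z (b(a := k)) * (\<Prod>i\<in>A. y i ^ b i)) * y a ^ k)"
proof -
  have *: "(\<Prod>i\<in>insert a A. y i ^ (b(a := k)) i) = y a ^ k * (\<Prod>i\<in>A. y i ^ b i)" for b k
  proof -
    have "(\<Prod>i\<in>A. y i ^ (b(a := k)) i) = (\<Prod>i\<in>A. y i ^ b i)"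
      using assms by (intro prod.cong) auto
    then show ?thesis using assms by simp
  qed
  show ?thesis
    unfolding PiE_insert_eq
    by (subst sum.reindex[OF inj_combinator[OF assms(2)]])
      (simp add: case_prod_unfold * sum.cartesian_product sum_distrib_left mult_ac del: fun_upd_apply)
qed

text \<open>Exponent vectors range over a box, each exponent being bounded separately, so that one
  variable can be split off. With the others fixed, the sum is a univariate polynomial vanishing on
  all of \<real>, and its coefficients are sums of the same kind over \<open>A\<close>.\<close>

lemma monomials_linearly_independent:
  fixes z :: "('a \<Rightarrow> nat) \<Rightarrow> real"
  assumes "finite A" "\<And>y. (\<Sum>b\<in>PiE A (\<lambda>_. {..D}). z b * (\<Prod>i\<in>A. y i ^ b i)) = 0"
    "b \<in> PiE A (\<lambda>_. {..D})"
  shows "z b = 0"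
  using assms
proof (induction A arbitrary: z b rule: finite_induct)
  case empty
  then show ?case by simp
next
  case (insert a A)
  obtain k b' where b: "b = b'(a := k)" "k \<le> D" "b' \<in> PiE A (\<lambda>_. {..D})"
    using insert.prems(2) by (auto simp: PiE_insert_eq)
  have "(\<Sum>b\<in>PiE A (\<lambda>_. {..D}). z (b(a := k)) * (\<Prod>i\<in>A. y i ^ b i)) = 0" for y :: "'a \<Rightarrow> real"
  proof -
    have "(\<Sum>k\<le>D. (\<Sum>b\<in>PiE A (\<lambda>_. {..D}). z (b(a := k)) * (\<Prod>i\<in>A. y i ^ b i)) * s ^ k) = 0" for s
    proof -
      have "(\<Prod>i\<in>A. (y(a := s)) i ^ b i) = (\<Prod>i\<in>A. y i ^ b i)" for b :: "'a \<Rightarrow> nat"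
        using insert.hyps by (intro prod.cong) auto
      then show ?thesis
        using insert.prems(1)[of "y(a := s)"]
        unfolding sum_monomials_insert[OF insert.hyps] by simp
    qed
    then show ?thesis
      using polyfun_eq_0[of "\<lambda>k. \<Sum>b\<in>PiE A (\<lambda>_. {..D}). z (b(a := k)) * (\<Prod>i\<in>A. y i ^ b i)" D]
        b(2) by blast
  qed
  then have "z (b'(a := k)) = 0"
    using insert.IH[where z = "\<lambda>b. z (b(a := k))" and b = b'] b(3) by blast
  then show ?case unfolding b(1) .
qed

section \<open>Zariski density and the number of algebraically independent functions\<close>

lemma poly_fun_sum_monomials:
  assumes "finite I" "poly_fun I D F"
  shows "\<exists>c. \<forall>x. F x = (\<Sum>b\<in>PiE I (\<lambda>_. {..D}). c b * (\<Prod>i\<in>I. x i ^ b i))"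
  using assms(2)
proof (induction rule: poly_fun.induct)
  case (const D c)
  \<comment> \<open>The zero exponent vector; members of \<open>PiE\<close> take the value
    \<open>undefined\<close> off \<open>I\<close>, hence the restriction.\<close>
  let ?b = "restrict (\<lambda>_. 0 :: nat) I"
  have b: "?b \<in> PiE I (\<lambda>_. {..D})" by auto
  have "(\<Sum>b\<in>PiE I (\<lambda>_. {..D}). (if b = ?b then c else 0) * (\<Prod>i\<in>I. x i ^ b i)) = c"
    for x :: "'a \<Rightarrow> real"
  proof -
    have "(if b = ?b then c else 0) * (\<Prod>i\<in>I. x i ^ b i) = (if b = ?b then c else 0)" for b
    proof (cases "b = ?b")
      case True
      have "(\<Prod>i\<in>I. x i ^ b i) = 1" unfolding True by simp
      then show ?thesis by (simp only: mult_1_right)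
    qed (simp only: if_False mult_zero_left)
    then have "(\<Sum>b\<in>PiE I (\<lambda>_. {..D}). (if b = ?b then c else 0) * (\<Prod>i\<in>I. x i ^ b i)) =
        (\<Sum>b\<in>PiE I (\<lambda>_. {..D}). if b = ?b then c else 0)"
      by (simp only:)
    also have "\<dots> = c" using b assms(1) by (subst sum.delta) (auto intro: finite_PiE)
    finally show ?thesis .
  qed
  then show ?case by (intro exI[of _ "\<lambda>b. if b = ?b then c else 0"]) (simp only: simp_thms)
next
  case (add D F G)
  then obtain c c' where
    "\<forall>x. F x = (\<Sum>b\<in>PiE I (\<lambda>_. {..D}). c b * (\<Prod>i\<in>I. x i ^ b i))"
    "\<forall>x. G x = (\<Sum>b\<in>PiE I (\<lambda>_. {..D}). c' b * (\<Prod>i\<in>I. x i ^ b i))" by auto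
  then show ?case
    by (intro exI[of _ "\<lambda>b. c b + c' b"]) (simp add: distrib_right sum.distrib)
next
  case (var_mult j D F)
  then obtain c where
    c: "\<And>x. F x = (\<Sum>b\<in>PiE I (\<lambda>_. {..D}). c b * (\<Prod>i\<in>I. x i ^ b i))" by auto
  let ?s = "\<lambda>b :: 'a \<Rightarrow> nat. b(j := Suc (b j))"
  let ?A = "PiE I (\<lambda>_. {..D})" and ?B = "PiE I (\<lambda>_. {..Suc D})"
  have inj: "inj_on ?s ?A"
    by (rule inj_on_inverseI[where g = "\<lambda>b. b(j := b j - 1)"]) auto
  \<comment> \<open>Multiplication by \<open>x j\<close> raises the exponent at \<open>j\<close> by
    one; coefficients move along, and vectors outside the image of this shift get 0.\<close>
  define c' where "c' b = (if b \<in> ?s ` ?A then c (b(j := b j - 1)) else 0)" for b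
  have sub: "?s ` ?A \<subseteq> ?B"
  proof (intro image_subsetI PiE_I)
    fix b i assume b: "b \<in> ?A"
    show "?s b i \<in> {..Suc D}" if "i \<in> I" using PiE_mem[OF b that] by auto
    show "?s b i = undefined" if "i \<notin> I"
      using that var_mult.hyps(1) PiE_arb[OF b that] by auto
  qed
  have "x j * F x = (\<Sum>b\<in>?B. c' b * (\<Prod>i\<in>I. x i ^ b i))" for x
  proof -
    have *: "(\<Prod>i\<in>I. x i ^ ?s b i) = x j * (\<Prod>i\<in>I. x i ^ b i)" for b
    proof -
      have "(\<Prod>i\<in>I - {j}. x i ^ ?s b i) = (\<Prod>i\<in>I - {j}. x i ^ b i)"
        by (intro prod.cong) auto
      then show ?thesis
        by (simp add: prod.remove[OF assms(1) var_mult.hyps(1)] mult.assoc)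
    qed
    have "(\<Sum>b\<in>?B. c' b * (\<Prod>i\<in>I. x i ^ b i)) = (\<Sum>b\<in>?s ` ?A. c' b * (\<Prod>i\<in>I. x i ^ b i))"
      by (rule sum.mono_neutral_right[OF _ sub]) (auto simp: c'_def assms(1) intro!: finite_PiE)
    also have "\<dots> = (\<Sum>b\<in>?A. c' (?s b) * (x j * (\<Prod>i\<in>I. x i ^ b i)))"
      by (subst sum.reindex[OF inj]) (simp only: o_def *)
    also have "\<dots> = (\<Sum>b\<in>?A. c b * (x j * (\<Prod>i\<in>I. x i ^ b i)))"
    proof (rule sum.cong)
      fix b assume "b \<in> ?A"
      then have "?s b \<in> ?s ` ?A" by blast
      then have "c' (?s b) = c b" unfolding c'_def by simp
      then show "c' (?s b) * (x j * (\<Prod>i\<in>I. x i ^ b i)) = c b * (x j * (\<Prod>i\<in>I. x i ^ b i))" by simp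
    qed simp
    finally show ?thesis by (simp add: c sum_distrib_left mult_ac)
  qed
  then show ?case by (intro exI[of _ c'] allI)
qed

text \<open>Zariski density of a subset of the affine space with coordinates \<open>A\<close>.\<close>

definition poly_dense :: "'a set \<Rightarrow> ('a \<Rightarrow> real) set \<Rightarrow> bool" where
  "poly_dense A X \<longleftrightarrow> (\<forall>F. polynomial_on A F \<longrightarrow> (\<forall>y\<in>X. F y = 0) \<longrightarrow> (\<forall>y. F y = 0))"

lemma poly_denseD:
  "poly_dense A X \<Longrightarrow> polynomial_on A F \<Longrightarrow> (\<And>y. y \<in> X \<Longrightarrow> F y = 0) \<Longrightarrow> F y = 0"
  unfolding poly_dense_def by blast

lemma poly_dense_mono: "poly_dense A X \<Longrightarrow> X \<subseteq> Y \<Longrightarrow> poly_dense A Y"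
  unfolding poly_dense_def by blast

text \<open>Points are total functions, but polynomials on \<open>A\<close> see only the coordinates
  in \<open>A\<close>. This lets restricted points, which are \<open>undefined\<close> elsewhere, be
  exchanged for unrestricted ones.\<close>

lemma poly_dense_cong:
  assumes "poly_dense A X" "\<And>x. x \<in> X \<Longrightarrow> \<exists>y\<in>Y. \<forall>a\<in>A. x a = y a"
  shows "poly_dense A Y"
  unfolding poly_dense_def
proof (intro allI impI)
  fix F y assume F: "polynomial_on A F" "\<forall>y\<in>Y. F y = 0"
  show "F y = 0"
  proof (rule poly_denseD[OF assms(1) F(1)])
    fix x assume "x \<in> X"
    then obtain y where "y \<in> Y" "\<forall>a\<in>A. x a = y a" using assms(2) by blast
    then show "F x = 0" using polynomial_on_cong[OF F(1), of x y] F(2) by simp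
  qed
qed

text \<open>For a large degree bound \<open>D\<close> there are more monomials in the \<open>g a\<close> with exponents at most
  \<open>D\<close> than monomials in the coordinates \<open>I\<close> available to express them.\<close>

lemma poly_dense_range_card_le:
  fixes g :: "'a \<Rightarrow> ('x \<Rightarrow> real) \<Rightarrow> real"
  assumes "finite A" "finite I" "\<And>a. a \<in> A \<Longrightarrow> polynomial_on I (g a)"
    and dense: "poly_dense A (range (\<lambda>x a. g a x))"
  shows "card A \<le> card I"
proof (rule ccontr)
  assume "\<not> card A \<le> card I"
  obtain M where M: "\<And>a. a \<in> A \<Longrightarrow> poly_fun I M (g a)"
    using poly_fun_common_degree[of A I g] assms(1,3) by blast
  \<comment> \<open>There are (\<open>card A * (K * M)\<close> + 1)^\<open>card I\<close> monomials
    in the coordinates, at most (\<open>card A * M\<close> + 1)^\<open>card I\<close> times (K +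
    1)^\<open>card I\<close>. With \<open>K\<close> equal to the first factor this is K (K +
    1)^\<open>card I\<close>, just below (K + 1)^(\<open>card I\<close> + 1).\<close>
  define K where "K = Suc (card A * M) ^ card I"
  let ?B = "PiE A (\<lambda>_. {..K})" and ?C = "PiE I (\<lambda>_. {..card A * (K * M)})"
  have "poly_fun I (card A * (K * M)) (\<lambda>x. \<Prod>a\<in>A. g a x ^ b a)" if "b \<in> ?B" for b
  proof (rule poly_fun_prod)
    fix a assume "a \<in> A"
    then have "b a \<le> K" using that by auto
    then show "poly_fun I (K * M) (\<lambda>x. g a x ^ b a)"
      using poly_fun_power[OF M[OF \<open>a \<in> A\<close>], of "b a"] by (rule_tac poly_fun_mono) auto
  qed
  then have "\<forall>b\<in>?B. \<exists>c. \<forall>x. (\<Prod>a\<in>A. g a x ^ b a) = (\<Sum>d\<in>?C. c d * (\<Prod>i\<in>I. x i ^ d i))"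
    by (intro ballI poly_fun_sum_monomials[OF assms(2)])
  from bchoice[OF this] obtain c where "\<forall>b\<in>?B. \<forall>x.
      (\<Prod>a\<in>A. g a x ^ b a) = (\<Sum>d\<in>?C. c b d * (\<Prod>i\<in>I. x i ^ d i))" ..
  then have c: "(\<Prod>a\<in>A. g a x ^ b a) = (\<Sum>d\<in>?C. c b d * (\<Prod>i\<in>I. x i ^ d i))"
    if "b \<in> ?B" for b x using that by simp
  have "Suc (card A * (K * M)) \<le> Suc (card A * M) * Suc K" 
    by (simp only: mult_Suc mult_Suc_right) (simp add: mult_ac)
  then have "Suc (card A * (K * M)) ^ card I \<le> K * Suc K ^ card I"
    unfolding K_def power_mult_distrib[symmetric] by (rule power_mono) simp
  also have "\<dots> < Suc K ^ Suc (card I)"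
    unfolding power_Suc by (rule mult_strict_right_mono) auto
  also have "\<dots> \<le> Suc K ^ card A"
    using \<open>\<not> card A \<le> card I\<close> by (intro power_increasing) auto
  finally have "card ?C < card ?B"
    unfolding card_PiE[OF assms(1)] card_PiE[OF assms(2)] prod_constant card_atMost .
  moreover have "finite ?B" "finite ?C" using assms(1,2) by (auto intro: finite_PiE)
  ultimately obtain z where z: "\<exists>b\<in>?B. z b \<noteq> 0"
      "\<And>d. d \<in> ?C \<Longrightarrow> (\<Sum>b\<in>?B. c b d * z b) = 0"
    using homogeneous_system_nontrivial_solution[of ?C ?B c] by auto
  \<comment> \<open>The linear relation \<open>z\<close> between the coefficient vectors of the
    products becomes a polynomial relation between the \<open>g a\<close>.\<close>
  let ?F = "\<lambda>y. \<Sum>b\<in>?B. z b * (\<Prod>a\<in>A. y a ^ b a)"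
  have "?F y = 0" for y
  proof (rule poly_denseD[OF dense, where F = ?F])
    show "polynomial_on A ?F"
      by (intro polynomial_on_sum polynomial_on_mult polynomial_on_const polynomial_on_prod
          polynomial_on_power polynomial_on_var)
    fix y assume "y \<in> range (\<lambda>x a. g a x)"
    then obtain x where x: "y = (\<lambda>a. g a x)" by auto
    have "?F y = (\<Sum>b\<in>?B. z b * (\<Sum>d\<in>?C. c b d * (\<Prod>i\<in>I. x i ^ d i)))"
      unfolding x using c by (intro sum.cong) auto
    also have "\<dots> = (\<Sum>d\<in>?C. (\<Sum>b\<in>?B. c b d * z b) * (\<Prod>i\<in>I. x i ^ d i))"
      unfolding sum_distrib_left sum_distrib_right by (subst sum.swap) (simp add: mult_ac)
    also have "\<dots> = 0" using z(2) by simp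
    finally show "?F y = 0" .
  qed
  then have "z b = 0" if "b \<in> ?B" for b
    using monomials_linearly_independent[where z = z and D = K and A = A and b = b] assms(1) that
    by simp
  then show False using z(1) by blast
qed

section \<open>Polynomials and polynomial functions\<close>

abbreviation (input) rmonom :: "('x \<Rightarrow> real) \<Rightarrow> ('x \<Rightarrow>\<^sub>0 nat) \<Rightarrow> real" where
  "rmonom x m \<equiv> \<Prod>i\<in>Poly_Mapping.keys m. x i ^ Poly_Mapping.lookup m i"

lemma rmonom_superset:
  assumes "finite A" "Poly_Mapping.keys m \<subseteq> A"
  shows "rmonom x m = (\<Prod>i\<in>A. x i ^ Poly_Mapping.lookup m i)"
  using assms by (intro prod.mono_neutral_left) (auto simp: in_keys_iff)

lemma rmonom_add: "rmonom x (m + m') = rmonom x m * rmonom x m'"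
proof -
  let ?A = "Poly_Mapping.keys m \<union> Poly_Mapping.keys m'"
  have A: "finite ?A" "Poly_Mapping.keys (m + m') \<subseteq> ?A" "Poly_Mapping.keys m \<subseteq> ?A"
    "Poly_Mapping.keys m' \<subseteq> ?A"
    by (auto simp: keys_add)
  show ?thesis
    unfolding rmonom_superset[OF A(1,2)] rmonom_superset[OF A(1,3)] rmonom_superset[OF A(1,4)]
    by (simp add: lookup_add power_add prod.distrib)
qed

definition reval :: "('x \<Rightarrow> real) \<Rightarrow> 'x rpoly \<Rightarrow> real" where
  "reval x Q = rsubst id x Q"

lemma reval_eq_sum: "reval x Q = (\<Sum>m\<in>Poly_Mapping.keys Q. Poly_Mapping.lookup Q m * rmonom x m)"
  by (simp add: reval_def rsubst_def)

lemma reval_superset: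
  assumes "finite K" "Poly_Mapping.keys Q \<subseteq> K"
  shows "reval x Q = (\<Sum>m\<in>K. Poly_Mapping.lookup Q m * rmonom x m)"
  unfolding reval_eq_sum using assms by (intro sum.mono_neutral_cong_left) (auto simp: in_keys_iff)

lemma reval_add: "reval x (P + Q) = reval x P + reval x Q"
proof -
  let ?A = "Poly_Mapping.keys P \<union> Poly_Mapping.keys Q"
  have A: "finite ?A" "Poly_Mapping.keys (P + Q) \<subseteq> ?A" "Poly_Mapping.keys P \<subseteq> ?A"
    "Poly_Mapping.keys Q \<subseteq> ?A"
    by (auto simp: keys_add)
  show ?thesis
    unfolding reval_superset[OF A(1,2)] reval_superset[OF A(1,3)] reval_superset[OF A(1,4)]
    by (simp add: lookup_add distrib_right sum.distrib)
qed

lemma reval_single: "reval x (Poly_Mapping.single m c) = c * rmonom x m"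
  by (simp add: reval_eq_sum)

lemma reval_rConst: "reval x (rConst c) = c"
  by (simp add: rConst_def reval_single)

lemma reval_rVar: "reval x (rVar i) = x i"
  by (simp add: rVar_def reval_single)

lemma reval_sum: "reval x (\<Sum>a\<in>A. P a) = (\<Sum>a\<in>A. reval x (P a))"
proof (induction A rule: infinite_finite_induct)
  case (insert a A)
  then show ?case by (simp add: reval_add)
qed (simp_all add: reval_eq_sum)

lemma poly_mapping_eq_sum_single:
  "Q = (\<Sum>m\<in>Poly_Mapping.keys Q. Poly_Mapping.single m (Poly_Mapping.lookup Q m))"
  by (rule poly_mapping_eqI) (simp add: lookup_sum lookup_single when_def in_keys_iff sum.delta')

lemma reval_mult: "reval x (P * Q) = reval x P * reval x Q"
proof -
  have "P * Q = (\<Sum>m\<in>Poly_Mapping.keys P. \<Sum>m'\<in>Poly_Mapping.keys Q.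
      Poly_Mapping.single (m + m') (Poly_Mapping.lookup P m * Poly_Mapping.lookup Q m'))"
    by (subst (1) poly_mapping_eq_sum_single[of P], subst (1) poly_mapping_eq_sum_single[of Q])
      (simp add: sum_product mult_single)
  then have "reval x (P * Q) = (\<Sum>m\<in>Poly_Mapping.keys P. \<Sum>m'\<in>Poly_Mapping.keys Q.
      (Poly_Mapping.lookup P m * Poly_Mapping.lookup Q m') * (rmonom x m * rmonom x m'))"
    by (simp add: reval_sum reval_single rmonom_add)
  also have "\<dots> = reval x P * reval x Q"
    by (simp add: reval_eq_sum sum_product mult_ac)
  finally show ?thesis .
qed

lemma reval_one: "reval x 1 = 1"
  using reval_rConst[of x 1] by (simp add: rConst_def)

lemma reval_uminus: "reval x (- P) = - reval x P"
  using reval_add[of x P "- P"] by (simp add: reval_eq_sum)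

lemma reval_diff: "reval x (P - Q) = reval x P - reval x Q"
  using reval_add[of x P "- Q"] by (simp add: reval_uminus)

lemma reval_power: "reval x (P ^ k) = reval x P ^ k"
  by (induction k) (auto simp: reval_mult reval_one)

lemma reval_prod: "reval x (\<Prod>a\<in>A. P a) = (\<Prod>a\<in>A. reval x (P a))"
  by (induction A rule: infinite_finite_induct) (auto simp: reval_mult reval_one)

lemma reval_compose:
  "reval x (rsubst rConst f Q) = reval (\<lambda>e. reval x (f e)) Q"
  by (simp add: rsubst_def reval_eq_sum[of _ Q]
      reval_sum reval_mult reval_prod reval_power reval_rConst)

lemma polynomial_on_reval:
  assumes "rvars Q \<subseteq> I"
  shows "polynomial_on I (\<lambda>x. reval x Q)"
  unfolding reval_eq_sum using assms
  by (intro polynomial_on_sum polynomial_on_mult polynomial_on_const polynomial_on_prod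
          polynomial_on_power polynomial_on_var) (auto simp: rvars_def)

lemma polynomial_on_imp_reval:
  assumes "polynomial_on I F"
  obtains Q where "rvars Q \<subseteq> I" "\<And>x. reval x Q = F x"
proof -
  obtain D where "poly_fun I D F" using assms by (auto simp: polynomial_on_def)
  then have "\<exists>Q. rvars Q \<subseteq> I \<and> (\<forall>x. reval x Q = F x)"
  proof (induction rule: poly_fun.induct)
    case (const D c)
    then show ?case
      by (intro exI[of _ "rConst c"]) (simp add: reval_rConst, simp add: rvars_def rConst_def)
  next
    case (add D F G)
    then obtain P Q where PQ: "rvars P \<subseteq> I" "\<forall>x. reval x P = F x"
      "rvars Q \<subseteq> I" "\<forall>x. reval x Q = G x" by auto
    moreover have "rvars (P + Q) \<subseteq> rvars P \<union> rvars Q"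
      using keys_add[of P Q] unfolding rvars_def by blast
    ultimately show ?case by (intro exI[of _ "P + Q"]) (auto simp: reval_add)
  next
    case (var_mult i D F)
    then obtain P where P: "rvars P \<subseteq> I" "\<forall>x. reval x P = F x" by auto
    have "rvars (rVar i * P) \<subseteq> insert i (rvars P)"
    proof
      fix j assume "j \<in> rvars (rVar i * P)"
      then obtain m where m: "m \<in> Poly_Mapping.keys (rVar i * P)" "j \<in> Poly_Mapping.keys m"
        by (auto simp: rvars_def)
      from m(1) keys_mult[of "rVar i" P] obtain a b where
        "m = a + b" "a \<in> Poly_Mapping.keys (rVar i)" "b \<in> Poly_Mapping.keys P" by blast
      then show "j \<in> insert i (rvars P)"
        using m(2) keys_add[of a b] by (auto simp: rVar_def rvars_def split: if_splits)
    qed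
    then show ?case using P var_mult.hyps
      by (intro exI[of _ "rVar i * P"]) (auto simp: reval_mult reval_rVar)
  qed
  then show ?thesis using that by blast
qed

text \<open>Over an infinite field a polynomial is determined by its values. Here
  \<open>\<mu>\<close> turns a vector in the box into a formal monomial, \<open>D\<close> is a crude
  bound for every exponent in \<open>Q\<close>, and the independence of monomial functions makes all
  coefficients vanish.\<close>

lemma rpoly_eq_0I:
  fixes Q :: "'x rpoly"
  assumes "finite I" "rvars Q \<subseteq> I" "\<And>x. reval x Q = 0"
  shows "Q = 0"
proof -
  define D where "D = (\<Sum>m\<in>Poly_Mapping.keys Q. \<Sum>i\<in>I. Poly_Mapping.lookup m i)"
  define \<mu> where "\<mu> b = Abs_poly_mapping (\<lambda>i. if i \<in> I then b i else 0)" for b :: "'x \<Rightarrow> nat"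
  have lookup_\<mu>: "Poly_Mapping.lookup (\<mu> b) = (\<lambda>i. if i \<in> I then b i else 0)" for b
    unfolding \<mu>_def using assms(1) by (intro Abs_poly_mapping_inverse) (auto intro: rev_finite_subset)
  let ?B = "PiE I (\<lambda>_. {..D})"
  have inj: "inj_on \<mu> ?B"
  proof (rule inj_onI)
    fix b b' assume b: "b \<in> ?B" "b' \<in> ?B" and "\<mu> b = \<mu> b'"
    then have "(if i \<in> I then b i else 0) = (if i \<in> I then b' i else 0)" for i
      using lookup_\<mu> by metis
    then have "b i = b' i" if "i \<in> I" for i using that by metis
    then show "b = b'" using b by (intro PiE_ext)
  qed
  have keys: "Poly_Mapping.keys Q \<subseteq> \<mu> ` ?B"
  proof
    fix m assume m: "m \<in> Poly_Mapping.keys Q"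
    then have "Poly_Mapping.lookup m i = 0" if "i \<notin> I" for i
      using assms(2) that unfolding rvars_def in_keys_iff[symmetric] not_in_keys_iff_lookup_eq_zero[symmetric]
      by blast
    then have "m = \<mu> (restrict (Poly_Mapping.lookup m) I)"
      by (intro poly_mapping_eqI) (auto simp: lookup_\<mu>)
    moreover have "Poly_Mapping.lookup m i \<le> D" if "i \<in> I" for i
    proof -
      have "Poly_Mapping.lookup m i \<le> (\<Sum>i\<in>I. Poly_Mapping.lookup m i)"
        using assms(1) that by (intro member_le_sum) auto
      also have "\<dots> \<le> D" unfolding D_def using m
        by (intro member_le_sum[of m "Poly_Mapping.keys Q"]) auto
      finally show ?thesis .
    qed
    ultimately show "m \<in> \<mu> ` ?B" by auto
  qed
  have fin: "finite ?B" using assms(1) by (intro finite_PiE) auto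
  have "(\<Sum>b\<in>?B. Poly_Mapping.lookup Q (\<mu> b) * (\<Prod>i\<in>I. x i ^ b i)) = 0" for x
  proof -
    have "(\<Prod>i\<in>I. x i ^ b i) = rmonom x (\<mu> b)" for b
    proof -
      have "Poly_Mapping.keys (\<mu> b) \<subseteq> I" by (auto simp: in_keys_iff lookup_\<mu> split: if_splits)
      from rmonom_superset[OF assms(1) this] show ?thesis by (simp add: lookup_\<mu>)
    qed
    then have "(\<Sum>b\<in>?B. Poly_Mapping.lookup Q (\<mu> b) * (\<Prod>i\<in>I. x i ^ b i)) =
      (\<Sum>m\<in>\<mu> ` ?B. Poly_Mapping.lookup Q m * rmonom x m)"
      by (subst sum.reindex[OF inj]) simp
    also have "\<dots> = reval x Q"
      using fin keys by (subst reval_superset) auto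
    finally show ?thesis using assms(3) by simp
  qed
  then have "Poly_Mapping.lookup Q (\<mu> b) = 0" if "b \<in> ?B" for b
    using monomials_linearly_independent[where z = "\<lambda>b. Poly_Mapping.lookup Q (\<mu> b)"
        and D = D and A = I and b = b] assms(1) that by simp
  then have "Poly_Mapping.lookup Q m = 0" if "m \<in> \<mu> ` ?B" for m using that by auto
  then have "Poly_Mapping.keys Q = {}"
    using keys lookup_not_eq_zero_eq_in_keys[of Q] by blast
  then show ?thesis by simp
qed

text \<open>A relation among the \<open>f e\<close> is a polynomial vanishing on the image of the
  map that they define. From here on formal polynomials can be replaced by functions.\<close>

lemma alg_independent_iff_poly_dense:
  fixes f :: "'e \<Rightarrow> 'x rpoly"
  assumes "finite E"
  shows "alg_independent E f \<longleftrightarrow> poly_dense E (range (\<lambda>x e. reval x (f e)))"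
proof
  assume indep: "alg_independent E f"
  show "poly_dense E (range (\<lambda>x e. reval x (f e)))"
    unfolding poly_dense_def
  proof (intro allI impI)
    fix F y assume F: "polynomial_on E F" "\<forall>y\<in>range (\<lambda>x e. reval x (f e)). F y = 0"
    obtain Q where Q: "rvars Q \<subseteq> E" "\<And>x. reval x Q = F x"
      using polynomial_on_imp_reval[OF F(1)] by blast
    \<comment> \<open>The variable type may be infinite; a single polynomial still involves finitely
      many variables, as \<open>rpoly_eq_0I\<close> asks.\<close>
    have "finite (rvars (rsubst rConst f Q))" by (auto simp: rvars_def)
    moreover have "reval x (rsubst rConst f Q) = 0" for x
      unfolding reval_compose Q(2) using F(2) by auto
    ultimately have "rsubst rConst f Q = 0" by (intro rpoly_eq_0I) auto
    then have "Q = 0" using indep Q(1) by (auto simp: alg_independent_def)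
    then show "F y = 0" using Q(2)[of y] by (simp add: reval_eq_sum)
  qed
next
  assume dense: "poly_dense E (range (\<lambda>x e. reval x (f e)))"
  show "alg_independent E f"
    unfolding alg_independent_def
  proof (intro allI impI)
    fix Q :: "'e rpoly" assume Q: "rvars Q \<subseteq> E" "rsubst rConst f Q = 0"
    have "reval y Q = 0" for y
    proof (rule poly_denseD[OF dense polynomial_on_reval[OF Q(1)]])
      fix y assume "y \<in> range (\<lambda>x e. reval x (f e))"
      then show "reval y Q = 0"
        using Q(2) by (auto simp flip: reval_compose) (simp add: reval_eq_sum)
    qed
    then show "Q = 0" using rpoly_eq_0I[OF assms Q(1)] by blast
  qed
qed

section \<open>Krull dimension of affine space\<close>

text \<open>Division with remainder by the variable \<open>a\<close>. The quotient's smaller degree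
  bound drives the induction over relations; at \<open>D = 0\<close> truncated subtraction shows no
  drop, so there the quotient is stated to be zero.\<close>

lemma poly_fun_split_var:
  assumes "poly_fun (insert a A) D F"
  shows "\<exists>F0 F1. polynomial_on A F0 \<and> poly_fun (insert a A) (D - 1) F1 \<and>
    (D = 0 \<longrightarrow> F1 = (\<lambda>_. 0)) \<and> (\<forall>y. F y = F0 y + y a * F1 y)"
  using assms
proof (induction rule: poly_fun.induct)
  case (const D c)
  show ?case
    by (rule exI[of _ "\<lambda>_. c"], rule exI[of _ "\<lambda>_. 0"])
      (simp add: polynomial_on_const poly_fun.const)
next
  case (add D F G)
  then obtain F0 F1 G0 G1 where
    F: "polynomial_on A F0" "poly_fun (insert a A) (D - 1) F1" "D = 0 \<longrightarrow> F1 = (\<lambda>_. 0)"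
      "\<forall>y. F y = F0 y + y a * F1 y" and
    G: "polynomial_on A G0" "poly_fun (insert a A) (D - 1) G1" "D = 0 \<longrightarrow> G1 = (\<lambda>_. 0)"
      "\<forall>y. G y = G0 y + y a * G1 y" by blast
  show ?case
    by (rule exI[of _ "\<lambda>y. F0 y + G0 y"], rule exI[of _ "\<lambda>y. F1 y + G1 y"])
      (use F G in \<open>auto simp: algebra_simps intro: polynomial_on_add poly_fun.add\<close>)
next
  case (var_mult i D F)
  then obtain F0 F1 where
    F: "polynomial_on A F0" "poly_fun (insert a A) (D - 1) F1" "D = 0 \<longrightarrow> F1 = (\<lambda>_. 0)"
      "\<forall>y. F y = F0 y + y a * F1 y" by blast
  show ?case
  proof (cases "i = a")
    case True
    show ?thesis
      by (rule exI[of _ "\<lambda>y. 0"], rule exI[of _ F])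
        (use var_mult True in \<open>auto intro: polynomial_on_const\<close>)
  next
    case False
    then have i: "i \<in> A" using var_mult by auto
    have "poly_fun (insert a A) D (\<lambda>y. y i * F1 y)"
    proof (cases D)
      case 0
      then show ?thesis using F(3) by (simp add: poly_fun.const)
    next
      case (Suc d)
      then show ?thesis using F(2) i by (auto intro: poly_fun.var_mult)
    qed
    then show ?thesis
      by (intro exI[of _ "\<lambda>y. y i * F0 y"] exI[of _ "\<lambda>y. y i * F1 y"])
        (use F i in \<open>auto simp: algebra_simps intro!: polynomial_on_mult polynomial_on_var\<close>)
  qed
qed

lemma zariski_closed_iff:
  "zariski_closed I Z \<longleftrightarrow> (\<exists>S. (\<forall>F\<in>S. polynomial_on I F) \<and> Z = {x \<in> I \<rightarrow>\<^sub>E UNIV. \<forall>F\<in>S. F x = 0})"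
proof
  assume "zariski_closed I Z"
  then obtain S where S: "\<forall>p\<in>S. rvars p \<subseteq> I" "Z = {x \<in> I \<rightarrow>\<^sub>E UNIV. \<forall>p\<in>S. reval x p = 0}"
    unfolding zariski_closed_def reval_def by blast
  show "\<exists>S. (\<forall>F\<in>S. polynomial_on I F) \<and> Z = {x \<in> I \<rightarrow>\<^sub>E UNIV. \<forall>F\<in>S. F x = 0}"
    by (rule exI[of _ "(\<lambda>p x. reval x p) ` S"]) (use S in \<open>auto intro: polynomial_on_reval\<close>)
next
  assume "\<exists>S. (\<forall>F\<in>S. polynomial_on I F) \<and> Z = {x \<in> I \<rightarrow>\<^sub>E UNIV. \<forall>F\<in>S. F x = 0}"
  then obtain S where S: "\<forall>F\<in>S. polynomial_on I F" "Z = {x \<in> I \<rightarrow>\<^sub>E UNIV. \<forall>F\<in>S. F x = 0}"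
    by blast
  have "\<forall>F\<in>S. \<exists>p. rvars p \<subseteq> I \<and> (\<forall>x. reval x p = F x)"
    using S(1) polynomial_on_imp_reval by metis
  from bchoice[OF this] obtain p where
    p: "\<forall>F\<in>S. rvars (p F) \<subseteq> I \<and> (\<forall>x. reval x (p F) = F x)" ..
  show "zariski_closed I Z"
    unfolding zariski_closed_def reval_def[symmetric]
    by (rule exI[of _ "p ` S"]) (use S(2) p in auto)
qed

lemma zariski_closed_Int_zeros:
  assumes "zariski_closed I Z" "polynomial_on I F"
  shows "zariski_closed I {x \<in> Z. F x = 0}"
proof -
  obtain S where S: "\<forall>F\<in>S. polynomial_on I F" "Z = {x \<in> I \<rightarrow>\<^sub>E UNIV. \<forall>F\<in>S. F x = 0}"
    using assms(1) unfolding zariski_closed_iff by blast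
  show ?thesis unfolding zariski_closed_iff
    by (rule exI[of _ "insert F S"]) (use S assms(2) in auto)
qed

lemma zariski_closed_subset: "zariski_closed I Z \<Longrightarrow> Z \<subseteq> I \<rightarrow>\<^sub>E UNIV"
  unfolding zariski_closed_iff by blast

lemma zariski_closed_space: "zariski_closed I (I \<rightarrow>\<^sub>E UNIV)"
  unfolding zariski_closed_iff by (rule exI[of _ "{}"]) auto

lemma zariski_closed_separate:
  assumes "zariski_closed I Z" "x \<in> I \<rightarrow>\<^sub>E UNIV" "x \<notin> Z"
  obtains F where "polynomial_on I F" "\<And>y. y \<in> Z \<Longrightarrow> F y = 0" "F x \<noteq> 0"
  using assms unfolding zariski_closed_iff by blast

text \<open>The zero sets of \<open>F\<close> and \<open>G\<close> in \<open>Z\<close> are closed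
  and cover \<open>Z\<close>. This is the primality of the vanishing ideal, expressed by
  functions.\<close>

lemma zariski_irreducible_mult:
  assumes "zariski_irreducible I Z" "polynomial_on I F" "polynomial_on I G"
    and "\<And>x. x \<in> Z \<Longrightarrow> F x * G x = 0"
  shows "(\<forall>x\<in>Z. F x = 0) \<or> (\<forall>x\<in>Z. G x = 0)"
proof -
  have "zariski_closed I Z" using assms(1) by (simp add: zariski_irreducible_def)
  then have "zariski_closed I {x \<in> Z. F x = 0}" "zariski_closed I {x \<in> Z. G x = 0}"
    using assms(2,3) zariski_closed_Int_zeros by blast+
  moreover have "Z = {x \<in> Z. F x = 0} \<union> {x \<in> Z. G x = 0}" using assms(4) by auto
  ultimately have "Z = {x \<in> Z. F x = 0} \<or> Z = {x \<in> Z. G x = 0}"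
    using assms(1) unfolding zariski_irreducible_def by blast
  then show ?thesis by blast
qed

text \<open>Functions \<open>p i\<close> that vanish on the \<open>i\<close>-th member of a chain of irreducible sets but not on
  the next one are algebraically independent on the last member: a relation splits into a part not
  involving the last function, which vanishes on the previous member, and a multiple of the last
  function, which can be cancelled.\<close>

lemma chain_separators_poly_dense:
  assumes irr: "\<And>i. i \<le> k \<Longrightarrow> zariski_irreducible I (C i)"
    and sub: "\<And>i. i < k \<Longrightarrow> C i \<subseteq> C (Suc i)"
    and p: "\<And>i. i < k \<Longrightarrow> polynomial_on I (p i)"
    and p0: "\<And>i x. i < k \<Longrightarrow> x \<in> C i \<Longrightarrow> p i x = 0"
    and p1: "\<And>i. i < k \<Longrightarrow> \<exists>x\<in>C (Suc i). p i x \<noteq> 0"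
    and "j \<le> k"
  shows "poly_dense {..<j} ((\<lambda>x i. p i x) ` C j)"
  using \<open>j \<le> k\<close>
proof (induction j)
  case 0
  \<comment> \<open>Without coordinates polynomial functions are constant, so density only requires
    that \<open>C 0\<close> is nonempty.\<close>
  then obtain x where "x \<in> C 0" using irr[of 0] by (auto simp: zariski_irreducible_def)
  moreover have "F y = F (\<lambda>i. p i x)" if "polynomial_on {..<0} F" for F y
    using that by (rule polynomial_on_cong) simp
  ultimately show ?case unfolding poly_dense_def by (metis imageI)
next
  case (Suc j)
  then have "j < k" and IH: "poly_dense {..<j} ((\<lambda>x i. p i x) ` C j)" by auto
  \<comment> \<open>Cancelling the last function lowers the degree bound \<open>D\<close>, which is
    the measure of the inner induction.\<close>
  have "\<forall>y. F y = 0" if "poly_fun (insert j {..<j}) D F" "\<forall>x\<in>C (Suc j). F (\<lambda>i. p i x) = 0" for D F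
    using that
  proof (induction D arbitrary: F)
    fix D F
    assume IHD: "\<And>F. poly_fun (insert j {..<j}) D F \<Longrightarrow> \<forall>x\<in>C (Suc j). F (\<lambda>i. p i x) = 0 \<Longrightarrow> \<forall>y. F y = 0"
    assume F: "poly_fun (insert j {..<j}) (Suc D) F" "\<forall>x\<in>C (Suc j). F (\<lambda>i. p i x) = 0"
    obtain F0 F1 where F0: "polynomial_on {..<j} F0" and F1: "poly_fun (insert j {..<j}) D F1"
      and eq: "\<And>y. F y = F0 y + y j * F1 y"
      using poly_fun_split_var[OF F(1)] by auto
    have "F0 y = 0" for y
    proof (rule poly_denseD[OF IH F0])
      fix y assume "y \<in> (\<lambda>x i. p i x) ` C j"
      then obtain x where x: "x \<in> C j" "y = (\<lambda>i. p i x)" by auto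
      then have "F y = 0" using F(2) sub[OF \<open>j < k\<close>] by auto
      then show "F0 y = 0" using eq[of y] x p0[OF \<open>j < k\<close> x(1)] by simp
    qed
    then have F_eq: "F y = y j * F1 y" for y using eq by simp
    have "polynomial_on I (\<lambda>x. F1 (\<lambda>i. p i x))"
    proof (rule polynomial_on_compose[where F = F1 and g = p and A = "insert j {..<j}"])
      show "polynomial_on (insert j {..<j}) F1" using F1 by (auto simp: polynomial_on_def)
    qed (use p \<open>j < k\<close> in auto)
    moreover have "p j x * F1 (\<lambda>i. p i x) = 0" if "x \<in> C (Suc j)" for x
      using F(2) F_eq that by auto
    ultimately have "(\<forall>x\<in>C (Suc j). p j x = 0) \<or> (\<forall>x\<in>C (Suc j). F1 (\<lambda>i. p i x) = 0)"
      using Suc.prems p[OF \<open>j < k\<close>]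
        zariski_irreducible_mult[OF irr[of "Suc j"], of "p j" "\<lambda>x. F1 (\<lambda>i. p i x)"] by blast
    then have "\<forall>x\<in>C (Suc j). F1 (\<lambda>i. p i x) = 0" using p1[OF \<open>j < k\<close>] by blast
    then have "\<forall>y. F1 y = 0" by (rule IHD[OF F1])
    then show "\<forall>y. F y = 0" using F_eq by simp
  next
    fix F
    assume F: "poly_fun (insert j {..<j}) 0 F" "\<forall>x\<in>C (Suc j). F (\<lambda>i. p i x) = 0"
    obtain F0 where F0: "polynomial_on {..<j} F0" "\<And>y. F y = F0 y"
      using poly_fun_split_var[OF F(1)] by auto
    have "F0 y = 0" for y
      by (rule poly_denseD[OF IH F0(1)]) (use F(2) F0(2) sub[OF \<open>j < k\<close>] in auto)
    then show "\<forall>y. F y = 0" using F0(2) by simp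
  qed
  then show ?case
    unfolding poly_dense_def polynomial_on_def lessThan_Suc by auto
qed

lemma zariski_chain_length_le:
  assumes "finite I" "\<And>i. i \<le> k \<Longrightarrow> zariski_irreducible I (C i)" "\<And>i. i < k \<Longrightarrow> C i \<subset> C (Suc i)"
  shows "k \<le> card I"
proof -
  have "\<exists>F. polynomial_on I F \<and> (\<forall>x\<in>C i. F x = 0) \<and> (\<exists>x\<in>C (Suc i). F x \<noteq> 0)" if "i < k" for i
  proof -
    obtain x where x: "x \<in> C (Suc i)" "x \<notin> C i" using assms(3)[OF \<open>i < k\<close>] by blast
    have "zariski_closed I (C i)" "zariski_closed I (C (Suc i))"
      using assms(2) \<open>i < k\<close> by (auto simp: zariski_irreducible_def)
    moreover from this(2) have "x \<in> I \<rightarrow>\<^sub>E UNIV" using x(1) zariski_closed_subset by blast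
    ultimately show ?thesis using x zariski_closed_separate[of I "C i" x] by metis
  qed
  then have "\<forall>i\<in>{..<k}. \<exists>F. polynomial_on I F \<and> (\<forall>x\<in>C i. F x = 0) \<and> (\<exists>x\<in>C (Suc i). F x \<noteq> 0)"
    by blast
  from bchoice[OF this] obtain p where p: "\<And>i. i < k \<Longrightarrow> polynomial_on I (p i)"
    "\<And>i x. i < k \<Longrightarrow> x \<in> C i \<Longrightarrow> p i x = 0" "\<And>i. i < k \<Longrightarrow> \<exists>x\<in>C (Suc i). p i x \<noteq> 0"
    by auto
  have "poly_dense {..<k} ((\<lambda>x i. p i x) ` C k)"
    using assms p by (intro chain_separators_poly_dense[of k I C]) auto
  \<comment> \<open>Enlarging \<open>C k\<close> to all points preserves density and yields the
    image of a polynomial map, to which the monomial count applies.\<close>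
  then have "poly_dense {..<k} (range (\<lambda>x i. p i x))"
    by (rule poly_dense_mono) auto
  from poly_dense_range_card_le[OF _ assms(1) _ this] p(1) show ?thesis by auto
qed

text \<open>If closed sets \<open>A\<close> and \<open>B\<close>, both proper, covered the subspace,
  then functions vanishing on \<open>A\<close> and on \<open>B\<close> would be nonzero at some
  \<open>x\<close> and \<open>y\<close> of it. A point of the line through \<open>x\<close> and
  \<open>y\<close> where neither vanishes lies in the subspace, but in neither set.\<close>

lemma zariski_irreducible_coordinate_subspace:
  fixes I :: "'c set"
  shows "zariski_irreducible I {x \<in> I \<rightarrow>\<^sub>E UNIV. \<forall>i\<in>J \<inter> I. x i = 0}" (is "zariski_irreducible I ?Z")
  unfolding zariski_irreducible_def
proof (intro conjI allI impI)
  show "zariski_closed I ?Z" unfolding zariski_closed_iff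
    by (rule exI[of _ "(\<lambda>i x. x i) ` (J \<inter> I)"]) (auto intro: polynomial_on_var)
  have "restrict (\<lambda>_. 0) I \<in> ?Z" by auto
  then show "?Z \<noteq> {}" by (intro notI) (simp only: empty_iff)
next
  fix A B assume A: "zariski_closed I A" and B: "zariski_closed I B" and Z: "?Z = A \<union> B"
  show "?Z = A \<or> ?Z = B"
  proof (rule ccontr)
    assume "\<not> (?Z = A \<or> ?Z = B)"
    then have "A \<union> B \<noteq> A" "A \<union> B \<noteq> B" unfolding Z by simp_all
    then obtain x y where "x \<in> A \<union> B" and xA: "x \<notin> A" and "y \<in> A \<union> B" and yB: "y \<notin> B" by blast
    then have x: "x \<in> ?Z" and y: "y \<in> ?Z" by (simp_all only: Z)
    obtain F where F: "polynomial_on I F" "\<And>z. z \<in> A \<Longrightarrow> F z = 0" "F x \<noteq> 0"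
      using zariski_closed_separate[OF A _ xA] x by auto
    obtain G where G: "polynomial_on I G" "\<And>z. z \<in> B \<Longrightarrow> G z = 0" "G y \<noteq> 0"
      using zariski_closed_separate[OF B _ yB] y by auto
    obtain t where t: "F (\<lambda>i. x i + t * (y i - x i)) \<noteq> 0" "G (\<lambda>i. x i + t * (y i - x i)) \<noteq> 0"
      by (rule polynomial_on_common_nonzero_on_line
          [where F = F and G = G and x = x and y = y and I = I, OF F(1) G(1) F(3) G(3)])
    define z where "z = restrict (\<lambda>i. x i + t * (y i - x i)) I"
    have "F z \<noteq> 0" "G z \<noteq> 0"
      using t polynomial_on_cong[OF F(1), of z "\<lambda>i. x i + t * (y i - x i)"]
        polynomial_on_cong[OF G(1), of z "\<lambda>i. x i + t * (y i - x i)"] by (simp_all add: z_def)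
    moreover have "z \<in> ?Z" using x y by (auto simp: z_def)
    then have "z \<in> A \<union> B" by (simp only: Z)
    ultimately show False using F(2) G(2) by blast
  qed
qed

lemma zariski_irreducible_space: "zariski_irreducible I (I \<rightarrow>\<^sub>E UNIV)"
  using zariski_irreducible_coordinate_subspace[of I "{}"] by simp

text \<open>Density makes the closure the whole space, where a flag of coordinate subspaces attains
  the bound; without density every chain in the closure can be prolonged by the whole space. For
  empty \<open>I\<close> and \<open>X\<close> the equivalence would fail: the dimension is 0 by
  convention, but the empty set is not dense.\<close>

theorem zariski_dim_eq_card_iff_poly_dense:
  assumes "finite I" "I \<noteq> {}" "X \<subseteq> I \<rightarrow>\<^sub>E UNIV"
  shows "zariski_dim I X = enat (card I) \<longleftrightarrow> poly_dense I X"
proof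
  assume dense: "poly_dense I X"
  have "Z = (I \<rightarrow>\<^sub>E UNIV)" if Z: "zariski_closed I Z" "X \<subseteq> Z" for Z
  proof (intro subset_antisym zariski_closed_subset[OF Z(1)] subsetI)
    fix x :: "'a \<Rightarrow> real" assume x: "x \<in> I \<rightarrow>\<^sub>E UNIV"
    show "x \<in> Z"
    proof (rule ccontr)
      assume "x \<notin> Z"
      then obtain F where F: "polynomial_on I F" "\<And>y. y \<in> Z \<Longrightarrow> F y = 0" "F x \<noteq> 0"
        using zariski_closed_separate[OF Z(1) x] by blast
      then show False using poly_denseD[OF dense F(1), of x] Z(2) by blast
    qed
  qed
  then have closure: "zariski_closure I X = (I \<rightarrow>\<^sub>E UNIV)"
    unfolding zariski_closure_def using zariski_closed_space assms(3) by blast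
  obtain h where h: "bij_betw h {0..<card I} I"
    using ex_bij_betw_nat_finite[OF assms(1)] by blast
  \<comment> \<open>\<open>C i\<close> leaves the first \<open>i\<close> coordinates in the
    enumeration \<open>h\<close> free: a flag from the origin to the whole space with
    \<open>card I\<close> strict steps.\<close>
  define C where "C i = {x \<in> I \<rightarrow>\<^sub>E (UNIV :: real set). \<forall>j\<in>h ` {i..<card I} \<inter> I. x j = 0}" for i
  have "C i \<subset> C (Suc i)" if "i < card I" for i
  proof
    show "C i \<subseteq> C (Suc i)" unfolding C_def by auto
    define x where "x = restrict (\<lambda>j. if j = h i then 1 else 0 :: real) I"
    have hi: "h i \<in> I" using h that by (auto simp: bij_betw_def)
    have "h j \<noteq> h i" if "j \<in> {Suc i..<card I}" for j
      using h that by (auto simp: bij_betw_def inj_on_eq_iff)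
    then have "x \<in> C (Suc i)" unfolding C_def x_def by auto
    moreover have "x \<notin> C i" using hi that unfolding C_def x_def by auto
    ultimately show "C i \<noteq> C (Suc i)" by blast
  qed
  moreover have "zariski_irreducible I (C i)" for i
    unfolding C_def by (rule zariski_irreducible_coordinate_subspace)
  moreover have "C i \<subseteq> zariski_closure I X" for i unfolding closure C_def by blast
  ultimately have "enat (card I) \<le> zariski_dim I X"
    unfolding zariski_dim_def by (intro Sup_upper) blast
  moreover have "zariski_dim I X \<le> enat (card I)"
    unfolding zariski_dim_def
  proof (rule Sup_least, clarify)
    fix k C assume "\<forall>i\<le>k. zariski_irreducible I (C i) \<and> C i \<subseteq> zariski_closure I X"
      "\<forall>i<k. C i \<subset> C (Suc i)"
    then show "enat k \<le> enat (card I)" using zariski_chain_length_le[OF assms(1), of k C] by simp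
  qed
  ultimately show "zariski_dim I X = enat (card I)" by simp
next
  assume dim: "zariski_dim I X = enat (card I)"
  show "poly_dense I X"
  proof (rule ccontr)
    assume "\<not> poly_dense I X"
    then obtain F y where F: "polynomial_on I F" "\<forall>x\<in>X. F x = 0" "F y \<noteq> 0"
      unfolding poly_dense_def by blast
    have "zariski_closed I {x \<in> I \<rightarrow>\<^sub>E UNIV. F x = 0}"
      by (rule zariski_closed_Int_zeros[OF zariski_closed_space F(1)])
    then have "zariski_closure I X \<subseteq> {x \<in> I \<rightarrow>\<^sub>E UNIV. F x = 0}"
      unfolding zariski_closure_def using F(2) assms(3) by blast
    moreover have "F (restrict y I) \<noteq> 0"
      using polynomial_on_cong[OF F(1), of "restrict y I" y] F(3) by simp
    ultimately have psub: "zariski_closure I X \<subset> (I \<rightarrow>\<^sub>E UNIV)"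
      using restrict_PiE_iff[of y I "\<lambda>_. UNIV"] by blast
    have "enat (card I - 1) < zariski_dim I X"
      unfolding dim using assms(1,2) by (simp add: card_gt_0_iff)
    \<comment> \<open>The supremum exceeds \<open>card I - 1\<close>, so some chain inside the
      closure has length at least \<open>card I\<close>; with the whole space on top it becomes too
      long.\<close>
    then obtain k C where k: "card I - 1 < k" and C: "\<forall>i\<le>k. zariski_irreducible I (C i) \<and>
        C i \<subseteq> zariski_closure I X" "\<forall>i<k. C i \<subset> C (Suc i)"
      unfolding zariski_dim_def less_Sup_iff by auto
    have "Suc k \<le> card I"
    proof (rule zariski_chain_length_le[OF assms(1), of _ "C(Suc k := I \<rightarrow>\<^sub>E UNIV)"])
      fix i assume "i \<le> Suc k"
      then show "zariski_irreducible I ((C(Suc k := I \<rightarrow>\<^sub>E UNIV)) i)"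
        using C(1) zariski_irreducible_space by (cases "i = Suc k") auto
    next
      fix i assume "i < Suc k"
      then show "(C(Suc k := I \<rightarrow>\<^sub>E UNIV)) i \<subset> (C(Suc k := I \<rightarrow>\<^sub>E UNIV)) (Suc i)"
      proof (cases "i = k")
        case True
        then show ?thesis using subset_psubset_trans[OF _ psub] C(1) by simp
      next
        case False
        then show ?thesis using C(2) \<open>i < Suc k\<close> by simp
      qed
    qed
    then show False using k by simp
  qed
qed

section \<open>The Jacobian criterion\<close>

text \<open>Differentiability is encoded as the chain rule along curves. No norm on the space of
  points enters, and this is the form in which compositions \<open>G (\<lambda>e. f e x)\<close> are
  differentiated.\<close>

definition has_gradient ::
    "'x set \<Rightarrow> (('x \<Rightarrow> real) \<Rightarrow> real) \<Rightarrow> ('x \<Rightarrow> ('x \<Rightarrow> real) \<Rightarrow> real) \<Rightarrow> bool" where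
  "has_gradient A F F' \<longleftrightarrow> (\<forall>y y' t. (\<forall>i\<in>A. ((\<lambda>s. y s i) has_real_derivative y' i) (at t)) \<longrightarrow>
     ((\<lambda>s. F (y s)) has_real_derivative (\<Sum>i\<in>A. F' i (y t) * y' i)) (at t))"

lemma has_gradientD:
  assumes "has_gradient A F F'" "\<And>i. i \<in> A \<Longrightarrow> ((\<lambda>s. y s i) has_real_derivative y' i) (at t)"
  shows "((\<lambda>s. F (y s)) has_real_derivative (\<Sum>i\<in>A. F' i (y t) * y' i)) (at t)"
  using assms unfolding has_gradient_def by blast

lemma has_gradient_line:
  assumes "has_gradient A F F'"
  shows "((\<lambda>s. F (\<lambda>i. x i + s * v i)) has_real_derivative
    (\<Sum>i\<in>A. F' i (\<lambda>i. x i + t * v i) * v i)) (at t)"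
  by (rule has_gradientD[OF assms]) (auto intro!: derivative_eq_intros)

lemma poly_fun_has_gradient:
  assumes "finite A" "poly_fun A D F"
  shows "\<exists>F'. has_gradient A F F' \<and> (\<forall>i. poly_fun A (D - 1) (F' i)) \<and> (D = 0 \<longrightarrow> F' = (\<lambda>_ _. 0))"
  using assms(2)
proof (induction rule: poly_fun.induct)
  case (const D c)
  show ?case
    by (rule exI[of _ "\<lambda>_ _. 0"]) (simp add: has_gradient_def poly_fun.const)
next
  case (add D F G)
  then obtain F' G' where
    F: "has_gradient A F F'" "\<forall>i. poly_fun A (D - 1) (F' i)" "D = 0 \<longrightarrow> F' = (\<lambda>_ _. 0)" and
    G: "has_gradient A G G'" "\<forall>i. poly_fun A (D - 1) (G' i)" "D = 0 \<longrightarrow> G' = (\<lambda>_ _. 0)" by blast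
  have "has_gradient A (\<lambda>x. F x + G x) (\<lambda>i x. F' i x + G' i x)"
    unfolding has_gradient_def
  proof (intro allI impI)
    fix y y' t assume "\<forall>i\<in>A. ((\<lambda>s. y s i) has_real_derivative y' i) (at t)"
    then have "((\<lambda>s. F (y s) + G (y s)) has_real_derivative
        (\<Sum>i\<in>A. F' i (y t) * y' i) + (\<Sum>i\<in>A. G' i (y t) * y' i)) (at t)"
      using has_gradientD[OF F(1), of y y' t] has_gradientD[OF G(1), of y y' t]
      by (intro DERIV_add) auto
    then show "((\<lambda>s. F (y s) + G (y s)) has_real_derivative
        (\<Sum>i\<in>A. (F' i (y t) + G' i (y t)) * y' i)) (at t)"
      by (simp add: distrib_right sum.distrib)
  qed
  then show ?case using F G
    by (intro exI[of _ "\<lambda>i x. F' i x + G' i x"]) (auto intro: poly_fun.add)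
next
  case (var_mult j D F)
  then obtain F' where
    F: "has_gradient A F F'" "\<forall>i. poly_fun A (D - 1) (F' i)" "D = 0 \<longrightarrow> F' = (\<lambda>_ _. 0)" by blast
  let ?F' = "\<lambda>i x. (if i = j then F x else 0) + x j * F' i x"
  have "has_gradient A (\<lambda>x. x j * F x) ?F'"
    unfolding has_gradient_def
  proof (intro allI impI)
    fix y y' t assume y: "\<forall>i\<in>A. ((\<lambda>s. y s i) has_real_derivative y' i) (at t)"
    have "((\<lambda>s. y s j * F (y s)) has_real_derivative
        y' j * F (y t) + (\<Sum>i\<in>A. F' i (y t) * y' i) * y t j) (at t)"
      using has_gradientD[OF F(1), of y y' t] y var_mult.hyps(1)
      by (intro DERIV_mult) auto
    moreover have "(\<Sum>i\<in>A. (if i = j then F (y t) else 0) * y' i) = F (y t) * y' j"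
      using assms(1) var_mult.hyps(1) by (subst sum.remove[of _ j]) auto
    then have "(\<Sum>i\<in>A. ((if i = j then F (y t) else 0) + y t j * F' i (y t)) * y' i) =
        y' j * F (y t) + (\<Sum>i\<in>A. F' i (y t) * y' i) * y t j"
      unfolding distrib_right sum.distrib by (simp add: sum_distrib_left mult_ac)
    ultimately show "((\<lambda>s. y s j * F (y s)) has_real_derivative
        (\<Sum>i\<in>A. ((if i = j then F (y t) else 0) + y t j * F' i (y t)) * y' i)) (at t)"
      by simp
  qed
  moreover have "poly_fun A D (\<lambda>x. x j * F' i x)" for i
  proof (cases D)
    case 0
    then show ?thesis using F(3) by (simp add: poly_fun.const)
  next
    case (Suc d)
    then show ?thesis using F(2) var_mult.hyps(1) by (auto intro: poly_fun.var_mult)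
  qed
  then have "poly_fun A D (?F' i)" for i
    using var_mult.hyps(2) by (cases "i = j") (simp_all add: poly_fun.add)
  ultimately show ?case by (intro exI[of _ ?F']) auto
qed

text \<open>Along the segment from \<open>y\<close> to \<open>x\<close>, a coordinate contributes
  nothing to the derivative if the points agree there or the partial derivative is zero. This covers
  both a vanishing gradient and independence of a single coordinate.\<close>

lemma has_gradient_zero_imp_const:
  assumes "has_gradient A F F'" "\<And>i z. i \<in> A \<Longrightarrow> x i \<noteq> y i \<Longrightarrow> F' i z = 0"
  shows "F x = F y"
proof -
  have zero: "F' i z * (y i - x i) = 0" if "i \<in> A" for i z
    using assms(2)[OF that] by (cases "x i = y i") auto
  have "((\<lambda>s. F (\<lambda>i. x i + s * (y i - x i))) has_real_derivative 0) (at t)" for t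
    using has_gradient_line[OF assms(1), of x "\<lambda>i. y i - x i" t] zero by simp
  then have "F (\<lambda>i. x i + 0 * (y i - x i)) = F (\<lambda>i. x i + 1 * (y i - x i))"
    by (intro DERIV_isconst_all[where f = "\<lambda>s. F (\<lambda>i. x i + s * (y i - x i))"]) auto
  then show ?thesis by simp
qed

text \<open>A relation of minimal degree: its partial derivatives have smaller degree and therefore are
  relations only if they vanish identically.\<close>

lemma minimal_relation:
  assumes "finite A" "\<not> poly_dense A X"
  shows "\<exists>G G'. polynomial_on A G \<and> (\<forall>y\<in>X. G y = 0) \<and> \<not> (\<forall>y. G y = 0) \<and>
    has_gradient A G G' \<and> (\<forall>a. polynomial_on A (G' a)) \<and>
    (\<forall>a. (\<forall>y\<in>X. G' a y = 0) \<longrightarrow> (\<forall>y. G' a y = 0))"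
proof -
  define P where "P D \<longleftrightarrow> (\<exists>G. poly_fun A D G \<and> (\<forall>y\<in>X. G y = 0) \<and> (\<exists>y. G y \<noteq> 0))" for D
  define D where "D = (LEAST D. P D)"
  have "\<exists>D. P D" using assms(2) unfolding poly_dense_def polynomial_on_def P_def by blast
  then have "P D" unfolding D_def by (rule LeastI_ex)
  then obtain G where G: "poly_fun A D G" "\<forall>y\<in>X. G y = 0" "\<exists>y. G y \<noteq> 0" unfolding P_def by blast
  obtain G' where G': "has_gradient A G G'" "\<forall>i. poly_fun A (D - 1) (G' i)"
    "D = 0 \<longrightarrow> G' = (\<lambda>_ _. 0)"
    using poly_fun_has_gradient[OF assms(1) G(1)] by blast
  have "G' a y = 0" if "\<And>x. x \<in> X \<Longrightarrow> G' a x = 0" for a y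
  proof (rule ccontr)
    assume ne: "G' a y \<noteq> 0"
    then have "D \<noteq> 0" using G'(3) by auto
    moreover have "P (D - 1)" using G'(2) that ne unfolding P_def by blast
    ultimately show False using not_less_Least[of "D - 1" P] by (simp add: D_def)
  qed
  with G G' show ?thesis by (intro exI[of _ G] exI[of _ G']) (auto simp: polynomial_on_def)
qed

text \<open>A polynomial family of kernel vectors may vanish at 0. Dividing out the common power of
  the variable yields one that does not, and its value at 0 is the required vector; each division
  lowers the degree of \<open>p e0\<close>.\<close>

lemma polynomial_kernel_at_0:
  fixes p :: "'e \<Rightarrow> real poly"
  assumes "finite E" "e0 \<in> E" "p e0 \<noteq> 0" "\<And>i. i \<in> I \<Longrightarrow> (\<Sum>e\<in>E. p e * q e i) = 0"
  shows "\<exists>w. (\<exists>e\<in>E. w e \<noteq> 0) \<and> (\<forall>i\<in>I. (\<Sum>e\<in>E. w e * poly (q e i) 0) = 0)"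
  using assms
proof (induction "degree (p e0)" arbitrary: p rule: less_induct)
  case less
  show ?case
  proof (cases "\<exists>e\<in>E. poly (p e) 0 \<noteq> 0")
    case True
    have "(\<Sum>e\<in>E. poly (p e) 0 * poly (q e i) 0) = 0" if "i \<in> I" for i
      using arg_cong[OF less.prems(4)[OF that], of "\<lambda>r. poly r 0"] by (simp add: poly_sum)
    then show ?thesis using True by (intro exI[of _ "\<lambda>e. poly (p e) 0"] conjI ballI)
  next
    case False
    then have "\<forall>e\<in>E. \<exists>r. p e = [:0, 1:] * r"
      using poly_eq_0_iff_dvd[of _ "0 :: real"] by (auto simp: dvd_def)
    from bchoice[OF this] obtain r where r: "\<And>e. e \<in> E \<Longrightarrow> p e = [:0, 1:] * r e" by blast
    have "r e0 \<noteq> 0" using r[OF less.prems(2)] less.prems(3) by auto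
    moreover from this have "degree (r e0) < degree (p e0)"
      using r[OF less.prems(2)] by (simp add: degree_mult_eq)
    moreover have "(\<Sum>e\<in>E. r e * q e i) = 0" if "i \<in> I" for i
    proof -
      have "[:0, 1:] * (\<Sum>e\<in>E. r e * q e i) = (\<Sum>e\<in>E. p e * q e i)"
        unfolding sum_distrib_left by (rule sum.cong) (simp_all add: r mult.assoc)
      then have "[:0, 1:] * (\<Sum>e\<in>E. r e * q e i) = 0" using less.prems(4)[OF that] by simp
      then show ?thesis by (simp only: mult_eq_0_iff) simp
    qed
    ultimately show ?thesis using less.hyps[of r] less.prems(1,2) by blast
  qed
qed

text \<open>By the chain rule the gradient of a minimal relation \<open>G\<close>, taken at the
  image of \<open>x\<close>, is a linear relation between the gradients of the \<open>f e\<close> at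
  every \<open>x\<close>. It may be trivial at \<open>\<xi>\<close> itself, so it is followed along
  a line from a point where it is not, and common factors are removed.\<close>

lemma jacobian_imp_poly_dense:
  fixes f :: "'e \<Rightarrow> ('x \<Rightarrow> real) \<Rightarrow> real" and f' :: "'e \<Rightarrow> 'x \<Rightarrow> ('x \<Rightarrow> real) \<Rightarrow> real"
  assumes fin: "finite E" "finite I"
    and f: "\<And>e. e \<in> E \<Longrightarrow> polynomial_on I (f e)"
    and grad: "\<And>e. e \<in> E \<Longrightarrow> has_gradient I (f e) (f' e)"
    and f': "\<And>e i. e \<in> E \<Longrightarrow> i \<in> I \<Longrightarrow> polynomial_on I (f' e i)"
    and indep: "\<And>w. (\<And>i. i \<in> I \<Longrightarrow> (\<Sum>e\<in>E. w e * f' e i \<xi>) = 0) \<Longrightarrow> \<forall>e\<in>E. w e = 0"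
  shows "poly_dense E (range (\<lambda>x e. f e x))"
proof (rule ccontr)
  assume "\<not> poly_dense E (range (\<lambda>x e. f e x))"
  from minimal_relation[OF fin(1) this] obtain G G' where G: "polynomial_on E G"
      "\<forall>y\<in>range (\<lambda>x e. f e x). G y = 0" "\<not> (\<forall>y. G y = 0)"
    and G': "has_gradient E G G'" "\<forall>a. polynomial_on E (G' a)"
    and min: "\<forall>a. (\<forall>y\<in>range (\<lambda>x e. f e x). G' a y = 0) \<longrightarrow> (\<forall>y. G' a y = 0)"
    by (elim exE conjE) (rule that)
  have rel: "(\<Sum>e\<in>E. G' e (\<lambda>e. f e x) * f' e i x) = 0" if "i \<in> I" for x i
  proof -
    define v where "v j = (if j = i then 1 else 0 :: real)" for j
    have "((\<lambda>s. f e (\<lambda>j. x j + s * v j)) has_real_derivative f' e i x) (at 0)" if "e \<in> E" for e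
    proof -
      have "(\<Sum>j\<in>I. f' e j x * v j) = f' e i x"
        using fin(2) \<open>i \<in> I\<close> by (subst sum.remove[of _ i]) (auto simp: v_def)
      then show ?thesis using has_gradient_line[OF grad[OF that], of x v 0] by simp
    qed
    then have "((\<lambda>s. G (\<lambda>e. f e (\<lambda>j. x j + s * v j))) has_real_derivative
        (\<Sum>e\<in>E. G' e (\<lambda>e. f e (\<lambda>j. x j + 0 * v j)) * f' e i x)) (at 0)"
      by (intro has_gradientD[OF G'(1)])
    moreover have "(\<lambda>s. G (\<lambda>e. f e (\<lambda>j. x j + s * v j))) = (\<lambda>_. 0)" using G(2) by auto
    ultimately show ?thesis using DERIV_unique[OF _ DERIV_const] by simp
  qed
  have "\<exists>e0\<in>E. \<exists>y. G' e0 y \<noteq> 0"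
  proof (rule ccontr)
    assume "\<not> (\<exists>e0\<in>E. \<exists>y. G' e0 y \<noteq> 0)"
    then have "G y = G (\<lambda>e. f e \<xi>)" for y
      by (intro has_gradient_zero_imp_const[OF G'(1)]) auto
    then show False using G(2,3) by auto
  qed
  then obtain e0 where e0: "e0 \<in> E" "\<not> (\<forall>y. G' e0 y = 0)" by auto
  \<comment> \<open>Minimality: a partial derivative that is not identically zero does not vanish on
    the whole image either.\<close>
  with min[rule_format, of e0] have "\<not> (\<forall>y\<in>range (\<lambda>x e. f e x). G' e0 y = 0)" by metis
  then obtain x1 where x1: "G' e0 (\<lambda>e. f e x1) \<noteq> 0" by auto
  \<comment> \<open>The line is at \<open>\<xi>\<close> for \<open>t = 0\<close> and at
    \<open>x1\<close> for \<open>t = 1\<close>, where the coefficient of \<open>e0\<close> is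
    nonzero; hence \<open>p e0\<close> is not the zero polynomial.\<close>
  define l where "l t = (\<lambda>i. \<xi> i + t * (x1 i - \<xi> i))" for t
  have "\<forall>e\<in>E. \<exists>p. \<forall>t. G' e (\<lambda>a. f a (l t)) = poly p t"
  proof
    fix e assume "e \<in> E"
    have "polynomial_on I (\<lambda>x. G' e (\<lambda>a. f a x))"
      by (rule polynomial_on_compose[where A = E and F = "G' e" and g = f]) (use G'(2) fin f in auto)
    then show "\<exists>p. \<forall>t. G' e (\<lambda>a. f a (l t)) = poly p t"
      unfolding l_def by (rule polynomial_on_line)
  qed
  from bchoice[OF this] obtain p where "\<forall>e\<in>E. \<forall>t. G' e (\<lambda>a. f a (l t)) = poly (p e) t" ..
  then have p: "G' e (\<lambda>a. f a (l t)) = poly (p e) t" if "e \<in> E" for e t using that by auto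
  have "\<forall>c\<in>E \<times> I. \<exists>q. \<forall>t. f' (fst c) (snd c) (l t) = poly q t"
    unfolding l_def by (intro ballI polynomial_on_line[where I = I] f') auto
  from bchoice[OF this] obtain q' where
    q': "\<forall>c\<in>E \<times> I. \<forall>t. f' (fst c) (snd c) (l t) = poly (q' c) t" ..
  define q where "q e i = q' (e, i)" for e i
  have q: "f' e i (l t) = poly (q e i) t" if "e \<in> E" "i \<in> I" for e i t
    using q' that by (auto simp: q_def)
  have "(\<Sum>e\<in>E. p e * q e i) = 0" if "i \<in> I" for i
  proof -
    have "poly (\<Sum>e\<in>E. p e * q e i) t = (\<Sum>e\<in>E. G' e (\<lambda>a. f a (l t)) * f' e i (l t))" for t
      unfolding poly_sum by (rule sum.cong) (simp_all add: p q that)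
    then have "\<forall>t. poly (\<Sum>e\<in>E. p e * q e i) t = 0" using rel[OF that] by simp
    then show ?thesis using poly_all_0_iff_0 by blast
  qed
  moreover have "p e0 \<noteq> 0" using p[OF e0(1), of 1] x1 by (auto simp: l_def)
  ultimately obtain w where w: "\<exists>e\<in>E. w e \<noteq> 0" "\<forall>i\<in>I. (\<Sum>e\<in>E. w e * poly (q e i) 0) = 0"
    using polynomial_kernel_at_0[of E e0 p I q] fin(1) e0(1) by auto
  have "(\<Sum>e\<in>E. w e * f' e i \<xi>) = 0" if "i \<in> I" for i
  proof -
    have "f' e i \<xi> = poly (q e i) 0" if "e \<in> E" for e
      using q[OF that \<open>i \<in> I\<close>, of 0] by (simp add: l_def)
    then show ?thesis using w(2) that by simp
  qed
  from indep[OF this] w(1) show False by blast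
qed

text \<open>Conversely, complete the \<open>f e\<close> by coordinates \<open>T\<close> to a maximal algebraically independent
  family. Differentiating a minimal relation for each remaining coordinate shows that, at a generic
  point, the gradients of the family span the whole space; by counting they form a basis.\<close>

lemma poly_dense_imp_jacobian:
  fixes f :: "'e \<Rightarrow> ('x \<Rightarrow> real) \<Rightarrow> real" and f' :: "'e \<Rightarrow> 'x \<Rightarrow> ('x \<Rightarrow> real) \<Rightarrow> real"
  assumes fin: "finite E" "finite I"
    and f: "\<And>e. e \<in> E \<Longrightarrow> polynomial_on I (f e)"
    and grad: "\<And>e. e \<in> E \<Longrightarrow> has_gradient I (f e) (f' e)"
    and dense: "poly_dense E (range (\<lambda>x e. f e x))"
    and h: "polynomial_on I h" "h z \<noteq> 0"
  obtains x where "h x \<noteq> 0"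
    "\<And>w. (\<And>i. i \<in> I \<Longrightarrow> (\<Sum>e\<in>E. w e * f' e i x) = 0) \<Longrightarrow> \<forall>e\<in>E. w e = 0"
proof -
  define g where "g = case_sum f (\<lambda>i x. x i)"
  have g_poly: "polynomial_on I (g a)" if "a \<in> E <+> I" for a
    using that f by (auto simp: g_def intro: polynomial_on_var)
  define dens where "dens T \<longleftrightarrow> poly_dense (E <+> T) (range (\<lambda>x a. g a x))" for T
  have "dens {}" unfolding dens_def poly_dense_def
  proof (intro allI impI)
    fix F and y :: "'e + 'x \<Rightarrow> real"
    assume F: "polynomial_on (E <+> {}) F" "\<forall>y\<in>range (\<lambda>x a. g a x). F y = 0"
    let ?ext = "\<lambda>u :: 'e \<Rightarrow> real. \<lambda>a :: 'e + 'x. case a of Inl e \<Rightarrow> u e | Inr _ \<Rightarrow> 0"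
    have "polynomial_on E (\<lambda>u. F (\<lambda>a. case a of Inl e \<Rightarrow> u e | Inr _ \<Rightarrow> 0))"
      by (rule polynomial_on_compose[OF F(1)]) (use fin in \<open>auto intro: polynomial_on_var\<close>)
    then have "F (?ext (\<lambda>e. y (Inl e))) = 0"
    proof (rule poly_denseD[OF dense])
      fix u assume "u \<in> range (\<lambda>x e. f e x)"
      then obtain x where x: "u = (\<lambda>e. f e x)" by auto
      have "F (?ext u) = F (\<lambda>a. g a x)"
        by (rule polynomial_on_cong[OF F(1)]) (auto simp: x g_def)
      then show "F (?ext u) = 0" using F(2) by auto
    qed
    moreover have "F (?ext (\<lambda>e. y (Inl e))) = F y"
      by (rule polynomial_on_cong[OF F(1)]) auto
    ultimately show "F y = 0" by simp
  qed
  define \<T> where "\<T> = {T. T \<subseteq> I \<and> dens T}"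
  have "{} \<in> \<T>" using \<open>dens {}\<close> by (simp add: \<T>_def)
  moreover have "finite \<T>" using fin(2) by (simp add: \<T>_def)
  ultimately obtain T where "T \<in> \<T>" and "\<forall>T'\<in>\<T>. T \<subseteq> T' \<longrightarrow> T = T'"
    using finite_has_maximal[of \<T>] by (metis empty_iff)
  then have T: "T \<subseteq> I" "dens T" and max: "\<And>T'. T' \<subseteq> I \<Longrightarrow> dens T' \<Longrightarrow> T \<subseteq> T' \<Longrightarrow> T = T'"
    by (auto simp: \<T>_def)
  have finT: "finite T" using T(1) fin(2) finite_subset by blast
  \<comment> \<open>\<open>H\<close> is the partial derivative, at the added coordinate
    \<open>j\<close>, of a minimal relation. Along a direction \<open>v\<close> killed by all
    gradients of the family, the derivative of the relation retains only the term
    \<open>H x * v j\<close>.\<close>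
  have "\<exists>H. polynomial_on I H \<and> (\<exists>x. H x \<noteq> 0) \<and>
      (\<forall>x v. (\<forall>e\<in>E. (\<Sum>i\<in>I. f' e i x * v i) = 0) \<longrightarrow> (\<forall>l\<in>T. v l = 0) \<longrightarrow> H x * v j = 0)"
    if j: "j \<in> I - T" for j
  proof -
    let ?A = "insert (Inr j) (E <+> T)"
    have "insert j T \<subseteq> I" "T \<noteq> insert j T" using T(1) j by auto
    then have "\<not> dens (insert j T)" using max[of "insert j T"] by blast
    moreover have A: "E <+> insert j T = ?A" by auto
    ultimately have "\<not> poly_dense ?A (range (\<lambda>x a. g a x))" unfolding dens_def by simp
    moreover have finA: "finite ?A" using fin(1) finT by auto
    ultimately have "\<exists>G G'. polynomial_on ?A G \<and> (\<forall>y\<in>range (\<lambda>x a. g a x). G y = 0) \<and>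
        \<not> (\<forall>y. G y = 0) \<and> has_gradient ?A G G' \<and> (\<forall>a. polynomial_on ?A (G' a)) \<and>
        (\<forall>a. (\<forall>y\<in>range (\<lambda>x a. g a x). G' a y = 0) \<longrightarrow> (\<forall>y. G' a y = 0))"
      by (intro minimal_relation)
    then obtain G G' where G: "polynomial_on ?A G"
        "\<forall>y\<in>range (\<lambda>x a. g a x). G y = 0" "\<not> (\<forall>y. G y = 0)"
      and G': "has_gradient ?A G G'" "\<forall>a. polynomial_on ?A (G' a)"
      and min: "\<forall>a. (\<forall>y\<in>range (\<lambda>x a. g a x). G' a y = 0) \<longrightarrow> (\<forall>y. G' a y = 0)"
      by (elim exE conjE) (rule that)
    let ?H = "\<lambda>x. G' (Inr j) (\<lambda>a. g a x)"
    have "polynomial_on I ?H"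
      by (rule polynomial_on_compose[where A = ?A and F = "G' (Inr j)" and g = g])
        (use G'(2) finA T(1) j in \<open>auto intro!: g_poly\<close>)
    moreover have "\<exists>x. ?H x \<noteq> 0"
    proof (rule ccontr)
      assume "\<not> (\<exists>x. ?H x \<noteq> 0)"
      then have "\<forall>y\<in>range (\<lambda>x a. g a x). G' (Inr j) y = 0" by auto
      then have "G' (Inr j) y = 0" for y using min[rule_format, of "Inr j"] by metis
      \<comment> \<open>A relation not depending on the coordinate \<open>j\<close> would be a
        relation for \<open>T\<close> itself, against its independence.\<close>
      then have indep_j: "G (y(Inr j := s)) = G y" for y s
        by (intro has_gradient_zero_imp_const[OF G'(1)]) (auto split: if_splits)
      have "polynomial_on (E <+> T) (\<lambda>y. G (\<lambda>a. (y(Inr j := 0)) a))"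
      proof (rule polynomial_on_compose[OF G(1) finA])
        fix a assume "a \<in> ?A"
        then show "polynomial_on (E <+> T) (\<lambda>y. (y(Inr j := 0)) a)"
          by (cases "a = Inr j") (auto intro: polynomial_on_var polynomial_on_const)
      qed
      then have "polynomial_on (E <+> T) G" by (simp only: indep_j)
      then have "G y = 0" for y
        using poly_denseD[OF T(2)[unfolded dens_def], of G y] G(2) by simp
      then show False using G(3) by blast
    qed
    moreover have "?H x * v j = 0"
      if v: "\<forall>e\<in>E. (\<Sum>i\<in>I. f' e i x * v i) = 0" "\<forall>l\<in>T. v l = 0" for x v
    proof -
      have "((\<lambda>s. g a (\<lambda>i. x i + s * v i)) has_real_derivative (if a = Inr j then v j else 0)) (at 0)"
        if a: "a \<in> ?A" for a
      proof (cases a)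
        case (Inl e)
        then have "e \<in> E" using a by auto
        then show ?thesis
          using has_gradient_line[OF grad[of e], of x v 0] v(1) Inl by (simp add: g_def)
      next
        case (Inr l)
        have "((\<lambda>s. x l + s * v l) has_real_derivative v l) (at 0)"
          by (auto intro!: derivative_eq_intros)
        then show ?thesis using a v(2) Inr by (auto simp: g_def)
      qed
      then have "((\<lambda>s. G (\<lambda>a. g a (\<lambda>i. x i + s * v i))) has_real_derivative
          (\<Sum>a\<in>?A. G' a (\<lambda>a. g a (\<lambda>i. x i + 0 * v i)) * (if a = Inr j then v j else 0))) (at 0)"
        by (intro has_gradientD[OF G'(1)])
      moreover have "(\<Sum>a\<in>?A. G' a (\<lambda>a. g a (\<lambda>i. x i + 0 * v i)) * (if a = Inr j then v j else 0)) =
          ?H x * v j"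
        using finA by (subst sum.remove[of _ "Inr j"]) auto
      moreover have "(\<lambda>s. G (\<lambda>a. g a (\<lambda>i. x i + s * v i))) = (\<lambda>_. 0)" using G(2) by auto
      ultimately show ?thesis using DERIV_unique[OF _ DERIV_const] by metis
    qed
    ultimately show ?thesis by blast
  qed
  then have "\<forall>j\<in>I - T. \<exists>H. polynomial_on I H \<and> (\<exists>x. H x \<noteq> 0) \<and>
      (\<forall>x v. (\<forall>e\<in>E. (\<Sum>i\<in>I. f' e i x * v i) = 0) \<longrightarrow> (\<forall>l\<in>T. v l = 0) \<longrightarrow> H x * v j = 0)"
    by blast
  from bchoice[OF this] obtain H where H: "\<forall>j\<in>I - T. polynomial_on I (H j) \<and> (\<exists>x. H j x \<noteq> 0) \<and>
      (\<forall>x v. (\<forall>e\<in>E. (\<Sum>i\<in>I. f' e i x * v i) = 0) \<longrightarrow> (\<forall>l\<in>T. v l = 0) \<longrightarrow> H j x * v j = 0)" ..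
  \<comment> \<open>The generic point avoids the zeros of \<open>h\<close> and of the finitely many
    \<open>H j\<close>.\<close>
  have "\<exists>x. \<forall>F\<in>insert h (H ` (I - T)). F x \<noteq> 0"
    by (rule polynomial_on_common_nonzero[of _ I "\<lambda>F. F"]) (use fin(2) h H in auto)
  then obtain x where x: "h x \<noteq> 0" "\<And>j. j \<in> I - T \<Longrightarrow> H j x \<noteq> 0" by blast
  define c where "c i b = (case b of Inl e \<Rightarrow> f' e i x | Inr l \<Rightarrow> if i = l then 1 else 0)" for i b
  have ker: "\<forall>i\<in>I. v i = 0" if v: "\<And>b. b \<in> E <+> T \<Longrightarrow> (\<Sum>i\<in>I. c i b * v i) = 0" for v
  proof
    fix j assume j: "j \<in> I"
    have vT: "\<forall>l\<in>T. v l = 0"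
    proof
      fix l assume l: "l \<in> T"
      have "(\<Sum>i\<in>I. (if i = l then 1 else 0) * v i) = v l"
        using fin(2) l T(1) by (subst sum.remove[of _ l]) auto
      then show "v l = 0" using v[of "Inr l"] l by (auto simp: c_def)
    qed
    show "v j = 0"
    proof (cases "j \<in> T")
      case False
      have "\<forall>e\<in>E. (\<Sum>i\<in>I. f' e i x * v i) = 0" using v[of "Inl _"] by (auto simp: c_def)
      then have "H j x * v j = 0" using H j False vT by blast
      then show ?thesis using x(2) j False by auto
    qed (use vT in blast)
  qed
  have card: "card (E <+> T) \<le> card I"
    by (rule poly_dense_range_card_le[OF _ fin(2) _ T(2)[unfolded dens_def]])
      (use fin finT T(1) in \<open>auto intro!: g_poly\<close>)
  show ?thesis
  proof (rule that[OF x(1)], rule ballI)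
    fix w e assume w: "\<And>i. i \<in> I \<Longrightarrow> (\<Sum>e\<in>E. w e * f' e i x) = 0" and e: "e \<in> E"
    define w' :: "'e + 'x \<Rightarrow> real" where "w' = case_sum w (\<lambda>_. 0)"
    have w'0: "(\<Sum>b\<in>E <+> T. w' b * c i b) = 0" if "i \<in> I" for i
      using w[OF that] fin(1) finT by (simp add: sum.Plus c_def w'_def)
    have "finite (E <+> T)" "Inl e \<in> E <+> T" using fin(1) finT e by auto
    from trivial_left_kernel[where c = c and w = w', OF fin(2) this(1) card ker w'0 this(2)]
    have "w' (Inl e) = 0" by blast
    then show "w e = 0" by (simp add: w'_def)
  qed
qed

section \<open>Stresses of Gram coordinates and of distances\<close>

definition inner_fun :: "nat \<Rightarrow> 'v \<Rightarrow> 'v \<Rightarrow> (nat \<times> 'v \<Rightarrow> real) \<Rightarrow> real" where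
  "inner_fun n a b x = (\<Sum>k<n. x (k, a) * x (k, b))"

text \<open>For \<open>a = b\<close> both terms contribute, which gives the factor 2 in the
  derivative of a square.\<close>

definition inner_grad :: "'v \<Rightarrow> 'v \<Rightarrow> nat \<times> 'v \<Rightarrow> (nat \<times> 'v \<Rightarrow> real) \<Rightarrow> real" where
  "inner_grad a b c x =
     x (fst c, b) * of_bool (snd c = a) + x (fst c, a) * of_bool (snd c = b)"

definition sq_dist_fun :: "nat \<Rightarrow> 'v \<Rightarrow> 'v \<Rightarrow> (nat \<times> 'v \<Rightarrow> real) \<Rightarrow> real" where
  "sq_dist_fun d a b x = (\<Sum>k<d. (x (k, a) - x (k, b))\<^sup>2)"

definition sq_dist_grad :: "'v \<Rightarrow> 'v \<Rightarrow> nat \<times> 'v \<Rightarrow> (nat \<times> 'v \<Rightarrow> real) \<Rightarrow> real" where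
  "sq_dist_grad a b c x =
     2 * (x (fst c, a) - x (fst c, b)) * (of_bool (snd c = a) - of_bool (snd c = b))"

lemma polynomial_on_inner_fun: "polynomial_on ({..<n} \<times> UNIV) (inner_fun n a b)"
  unfolding inner_fun_def
  by (intro polynomial_on_sum polynomial_on_mult polynomial_on_var) auto

lemma polynomial_on_inner_grad:
  "c \<in> {..<n} \<times> UNIV \<Longrightarrow> polynomial_on ({..<n} \<times> UNIV) (inner_grad a b c)"
  unfolding inner_grad_def
  by (intro polynomial_on_add polynomial_on_mult polynomial_on_var polynomial_on_const) auto

lemma polynomial_on_sq_dist_fun: "polynomial_on ({..<d} \<times> UNIV) (sq_dist_fun d a b)"
  unfolding sq_dist_fun_def
  by (intro polynomial_on_sum polynomial_on_power polynomial_on_diff polynomial_on_var) auto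

lemma polynomial_on_sq_dist_grad:
  "c \<in> {..<d} \<times> UNIV \<Longrightarrow> polynomial_on ({..<d} \<times> UNIV) (sq_dist_grad a b c)"
  unfolding sq_dist_grad_def
  by (intro polynomial_on_diff polynomial_on_mult polynomial_on_var polynomial_on_const) auto

lemma sum_of_bool_eq:
  fixes h :: "'v::finite \<Rightarrow> real"
  shows "(\<Sum>i\<in>UNIV. c * of_bool (i = a) * h i) = c * h a"
  by (subst sum.remove[of _ a]) auto

lemma has_gradient_inner_fun:
  fixes a b :: "'v::finite"
  shows "has_gradient ({..<n} \<times> UNIV) (inner_fun n a b) (inner_grad a b)"
  unfolding has_gradient_def
proof (intro allI impI)
  fix y y' and t :: real
  assume y: "\<forall>i\<in>{..<n} \<times> (UNIV :: 'v set). ((\<lambda>s. y s i) has_real_derivative y' i) (at t)"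
  have "((\<lambda>s. \<Sum>k<n. y s (k, a) * y s (k, b)) has_real_derivative
      (\<Sum>k<n. y' (k, a) * y t (k, b) + y' (k, b) * y t (k, a))) (at t)"
    using y by (intro DERIV_sum DERIV_mult) auto
  moreover have "(\<Sum>c\<in>{..<n} \<times> UNIV. inner_grad a b c (y t) * y' c) =
      (\<Sum>k<n. \<Sum>i\<in>UNIV. inner_grad a b (k, i) (y t) * y' (k, i))"
    by (simp add: sum.cartesian_product)
  moreover have "\<dots> = (\<Sum>k<n. y' (k, a) * y t (k, b) + y' (k, b) * y t (k, a))"
    by (simp only: inner_grad_def fst_conv snd_conv distrib_right sum.distrib sum_of_bool_eq)
      (simp add: mult.commute)
  ultimately show "((\<lambda>s. inner_fun n a b (y s)) has_real_derivative
      (\<Sum>c\<in>{..<n} \<times> UNIV. inner_grad a b c (y t) * y' c)) (at t)"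
    by (simp add: inner_fun_def)
qed

lemma has_gradient_sq_dist_fun:
  fixes a b :: "'v::finite"
  shows "has_gradient ({..<d} \<times> UNIV) (sq_dist_fun d a b) (sq_dist_grad a b)"
  unfolding has_gradient_def
proof (intro allI impI)
  fix y y' and t :: real
  assume y: "\<forall>i\<in>{..<d} \<times> (UNIV :: 'v set). ((\<lambda>s. y s i) has_real_derivative y' i) (at t)"
  have "((\<lambda>s. \<Sum>k<d. (y s (k, a) - y s (k, b))\<^sup>2) has_real_derivative
      (\<Sum>k<d. 2 * (y t (k, a) - y t (k, b)) * (y' (k, a) - y' (k, b)))) (at t)"
    using y by (intro DERIV_sum) (auto intro!: derivative_eq_intros)
  moreover have "(\<Sum>c\<in>{..<d} \<times> UNIV. sq_dist_grad a b c (y t) * y' c) =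
      (\<Sum>k<d. \<Sum>i\<in>UNIV. sq_dist_grad a b (k, i) (y t) * y' (k, i))"
    by (simp add: sum.cartesian_product)
  moreover have "\<dots> = (\<Sum>k<d. 2 * (y t (k, a) - y t (k, b)) * (y' (k, a) - y' (k, b)))"
    by (simp only: sq_dist_grad_def fst_conv snd_conv right_diff_distrib[of "2 * (y t (_, a) - y t (_, b))"]
        left_diff_distrib[of _ _ "y' _"] sum_subtractf sum_of_bool_eq)
  ultimately show "((\<lambda>s. sq_dist_fun d a b (y s)) has_real_derivative
      (\<Sum>c\<in>{..<d} \<times> UNIV. sq_dist_grad a b c (y t) * y' c)) (at t)"
    by (simp add: sq_dist_fun_def)
qed

text \<open>\<open>u\<close> and \<open>w\<close> name the two endpoints of each edge. That they
  really are its endpoints matters only for the comparison with \<open>graph_proj\<close> and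
  \<open>on_edge\<close>.\<close>

definition gram_fun ::
    "nat \<Rightarrow> ('v set \<Rightarrow> 'v) \<Rightarrow> ('v set \<Rightarrow> 'v) \<Rightarrow> 'v + 'v set \<Rightarrow> (nat \<times> 'v \<Rightarrow> real) \<Rightarrow> real" where
  "gram_fun n u w c = (case c of Inl v \<Rightarrow> inner_fun n v v | Inr e \<Rightarrow> inner_fun n (u e) (w e))"

definition gram_grad ::
    "('v set \<Rightarrow> 'v) \<Rightarrow> ('v set \<Rightarrow> 'v) \<Rightarrow> 'v + 'v set \<Rightarrow> nat \<times> 'v \<Rightarrow> (nat \<times> 'v \<Rightarrow> real) \<Rightarrow> real" where
  "gram_grad u w c = (case c of Inl v \<Rightarrow> inner_grad v v | Inr e \<Rightarrow> inner_grad (u e) (w e))"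

text \<open>This is the equilibrium condition at vertex \<open>i\<close> in row \<open>k\<close>:
  each edge at \<open>i\<close> contributes the weighted position of its other end, and the diagonal
  weight counts twice.\<close>

lemma gram_stress_sum:
  fixes E :: "'v::finite set set"
  shows "(\<Sum>c\<in>graph_coords E. \<omega> c * gram_grad u w c (k, i) x) = 2 * \<omega> (Inl i) * x (k, i) +
    (\<Sum>e\<in>E. \<omega> (Inr e) * (x (k, w e) * of_bool (i = u e) + x (k, u e) * of_bool (i = w e)))"
proof -
  have "(\<Sum>v\<in>UNIV. \<omega> (Inl v) * inner_grad v v (k, i) x) = 2 * \<omega> (Inl i) * x (k, i)"
    by (subst sum.remove[of _ i]) (auto simp: inner_grad_def)
  then show ?thesis
    by (simp add: graph_coords_def sum.Plus gram_grad_def) (simp add: inner_grad_def)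
qed

text \<open>In both lemmas \<open>p\<^sub>i = \<lambda>\<^sub>i (q\<^sub>i, 1)\<close>: a stress of the Gram coordinates at \<open>p\<close> is, after scaling by
  \<open>\<lambda>\<^sub>i \<lambda>\<^sub>j\<close>, a stress of the distance functions at \<open>q\<close>, the last coordinate only determining the
  diagonal entries.\<close>

lemma sq_dist_independent_imp_gram:
  fixes E :: "'v::finite set set"
  assumes indep: "\<And>\<omega>. (\<And>c. c \<in> {..<d} \<times> UNIV \<Longrightarrow>
      (\<Sum>e\<in>E. \<omega> e * sq_dist_grad (u e) (w e) c q) = 0) \<Longrightarrow> \<forall>e\<in>E. \<omega> e = 0"
    and stress: "\<And>c. c \<in> {..<Suc d} \<times> UNIV \<Longrightarrow>
      (\<Sum>a\<in>graph_coords E. \<omega> a * gram_grad u w a c (\<lambda>(k, i). if k < d then q (k, i) else 1)) = 0"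
  shows "\<forall>a\<in>graph_coords E. \<omega> a = 0"
proof -
  \<comment> \<open>Row \<open>d\<close> of the point consists of ones, so its condition expresses
    the diagonal weights by the edge weights.\<close>
  have last: "(\<Sum>e\<in>E. \<omega> (Inr e) * (of_bool (i = u e) + of_bool (i = w e))) = - 2 * \<omega> (Inl i)" for i
    using stress[of "(d, i)"] unfolding gram_stress_sum by simp
  have first: "(\<Sum>e\<in>E. \<omega> (Inr e) * (q (k, w e) * of_bool (i = u e) + q (k, u e) * of_bool (i = w e)))
      = - 2 * \<omega> (Inl i) * q (k, i)" if "k < d" for k i
    using stress[of "(k, i)"] that unfolding gram_stress_sum by simp
  have "(\<Sum>e\<in>E. \<omega> (Inr e) * sq_dist_grad (u e) (w e) c q) = 0" if "c \<in> {..<d} \<times> UNIV" for c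
  proof -
    obtain k i where c: "c = (k, i)" "k < d" using \<open>c \<in> _\<close> by auto
    \<comment> \<open>Twice \<open>q (k, i)\<close> times the condition of row \<open>d\<close>,
      minus twice that of row \<open>k\<close>, eliminates the diagonal weight.\<close>
    have "(\<Sum>e\<in>E. \<omega> (Inr e) * sq_dist_grad (u e) (w e) c q) =
      (\<Sum>e\<in>E. 2 * q (k, i) * (\<omega> (Inr e) * (of_bool (i = u e) + of_bool (i = w e))) -
        2 * (\<omega> (Inr e) * (q (k, w e) * of_bool (i = u e) + q (k, u e) * of_bool (i = w e))))"
      by (rule sum.cong) (auto simp: sq_dist_grad_def c of_bool_def algebra_simps)
    also have "\<dots> = 0"
      unfolding sum_subtractf sum_distrib_left[symmetric] last first[OF c(2)] by simp
    finally show ?thesis .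
  qed
  from indep[OF this] have "\<forall>e\<in>E. \<omega> (Inr e) = 0" .
  moreover from this have "\<omega> (Inl i) = 0" for i using last[of i] by simp
  ultimately show ?thesis by (auto simp: graph_coords_def)
qed

lemma gram_independent_imp_sq_dist:
  fixes E :: "'v::finite set set"
  assumes nz: "\<And>i. p (d, i) \<noteq> 0"
    and indep: "\<And>\<omega>. (\<And>c. c \<in> {..<Suc d} \<times> UNIV \<Longrightarrow>
      (\<Sum>a\<in>graph_coords E. \<omega> a * gram_grad u w a c p) = 0) \<Longrightarrow> \<forall>a\<in>graph_coords E. \<omega> a = 0"
    and stress: "\<And>c. c \<in> {..<d} \<times> UNIV \<Longrightarrow>
      (\<Sum>e\<in>E. \<omega> e * sq_dist_grad (u e) (w e) c (\<lambda>(k, i). p (k, i) / p (d, i))) = 0"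
  shows "\<forall>e\<in>E. \<omega> e = 0"
proof -
  define S where "S i = (\<Sum>e\<in>E. \<omega> e * (of_bool (i = u e) + of_bool (i = w e)))" for i
  \<comment> \<open>The edge weights undo the scaling by the last coordinates; the diagonal weights
    are those forced by the equilibrium condition in row \<open>d\<close>.\<close>
  define \<Omega> where "\<Omega> = case_sum (\<lambda>i. - S i / (2 * p (d, i) ^ 2)) (\<lambda>e. \<omega> e / (p (d, u e) * p (d, w e)))"
  define q where "q = (\<lambda>(k, i). p (k, i) / p (d, i))"
  have p: "p (k, i) = p (d, i) * q (k, i)" for k i using nz by (simp add: q_def)
  \<comment> \<open>Row \<open>d\<close> of \<open>q\<close> is constantly 1, so distance gradients
    vanish there and the stress condition extends to all rows.\<close>
  have q0: "(\<Sum>e\<in>E. \<omega> e * sq_dist_grad (u e) (w e) (k, i) q) = 0" if "k < Suc d" for k i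
  proof (cases "k = d")
    case True
    then show ?thesis using nz by (simp add: sq_dist_grad_def q_def)
  next
    case False
    then show ?thesis using stress[of "(k, i)"] that by (simp add: q_def)
  qed
  have "(\<Sum>a\<in>graph_coords E. \<Omega> a * gram_grad u w a c p) = 0" if "c \<in> {..<Suc d} \<times> UNIV" for c
  proof -
    obtain k i where c: "c = (k, i)" "k < Suc d" using \<open>c \<in> _\<close> by auto
    have "(\<Sum>e\<in>E. \<Omega> (Inr e) * (p (k, w e) * of_bool (i = u e) + p (k, u e) * of_bool (i = w e))) =
      (\<Sum>e\<in>E. (\<omega> e * (of_bool (i = u e) + of_bool (i = w e))) * (q (k, i) / p (d, i)) -
        (\<omega> e * sq_dist_grad (u e) (w e) (k, i) q) * (1 / (2 * p (d, i))))"
      by (rule sum.cong)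
        (use nz in \<open>auto simp: \<Omega>_def p[of k] sq_dist_grad_def of_bool_def field_simps\<close>)
    also have "\<dots> = S i * (q (k, i) / p (d, i))"
      unfolding sum_subtractf sum_distrib_right[symmetric] q0[OF c(2)] S_def by simp
    finally show ?thesis
      unfolding c(1) gram_stress_sum using nz[of i]
      by (simp add: \<Omega>_def p[of k] field_simps power2_eq_square)
  qed
  from indep[OF this] have "\<forall>e\<in>E. \<Omega> (Inr e) = 0" by (auto simp: graph_coords_def)
  then show ?thesis using nz by (auto simp: \<Omega>_def)
qed

text \<open>Each direction extracts a point with independent gradients and transforms it:
  \<open>p\<close> is divided by its last row, while a row of ones is appended to \<open>q\<close>.
  The product of the last-row entries is the function kept nonzero at \<open>p\<close>.\<close>

lemma poly_dense_gram_iff_sq_dist: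
  fixes E :: "'v::finite set set"
  shows "poly_dense (graph_coords E) (range (\<lambda>x c. gram_fun (Suc d) u w c x)) \<longleftrightarrow>
    poly_dense E (range (\<lambda>x e. sq_dist_fun d (u e) (w e) x))"
proof -
  let ?I = "\<lambda>n :: nat. {..<n} \<times> (UNIV :: 'v set)"
  have fin: "finite (graph_coords E)" "finite E" "\<And>n. finite (?I n)"
    by (auto simp: graph_coords_def)
  have gram: "polynomial_on (?I n) (gram_fun n u w a)" "has_gradient (?I n) (gram_fun n u w a) (gram_grad u w a)"
    "c \<in> ?I n \<Longrightarrow> polynomial_on (?I n) (gram_grad u w a c)" for n a c
    by (auto simp: gram_fun_def gram_grad_def polynomial_on_inner_fun polynomial_on_inner_grad
        has_gradient_inner_fun split: sum.split)
  show ?thesis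
  proof
    assume dense: "poly_dense (graph_coords E) (range (\<lambda>x c. gram_fun (Suc d) u w c x))"
    have h: "polynomial_on (?I (Suc d)) (\<lambda>x. \<Prod>i\<in>UNIV. x (d, i))"
      by (intro polynomial_on_prod polynomial_on_var) auto
    have hz: "(\<Prod>i\<in>UNIV. (\<lambda>_ :: nat \<times> 'v. 1 :: real) (d, i)) \<noteq> 0" by simp
    obtain p where p: "(\<Prod>i\<in>UNIV. p (d, i)) \<noteq> 0"
      and indep: "\<And>\<omega>. (\<And>c. c \<in> ?I (Suc d) \<Longrightarrow>
        (\<Sum>a\<in>graph_coords E. \<omega> a * gram_grad u w a c p) = 0) \<Longrightarrow> \<forall>a\<in>graph_coords E. \<omega> a = 0"
    proof (rule poly_dense_imp_jacobian[where E = "graph_coords E" and I = "?I (Suc d)"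
          and f = "gram_fun (Suc d) u w" and f' = "gram_grad u w"
          and h = "\<lambda>x. \<Prod>i\<in>UNIV. x (d, i)" and z = "\<lambda>_. 1"])
      fix p assume "(\<Prod>i\<in>UNIV. p (d, i)) \<noteq> 0"
        "\<And>\<omega>. (\<And>c. c \<in> ?I (Suc d) \<Longrightarrow>
          (\<Sum>a\<in>graph_coords E. \<omega> a * gram_grad u w a c p) = 0) \<Longrightarrow> \<forall>a\<in>graph_coords E. \<omega> a = 0"
      then show thesis by (rule that)
    qed (use fin gram dense h hz in simp_all)
    have nz: "p (d, i) \<noteq> 0" for i using p by simp
    show "poly_dense E (range (\<lambda>x e. sq_dist_fun d (u e) (w e) x))"
    proof (rule jacobian_imp_poly_dense[where I = "?I d" and f' = "\<lambda>e. sq_dist_grad (u e) (w e)"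
          and \<xi> = "\<lambda>(k, i). p (k, i) / p (d, i)"])
      fix \<omega> assume stress: "\<And>c. c \<in> ?I d \<Longrightarrow>
        (\<Sum>e\<in>E. \<omega> e * sq_dist_grad (u e) (w e) c (\<lambda>(k, i). p (k, i) / p (d, i))) = 0"
      show "\<forall>e\<in>E. \<omega> e = 0"
        by (rule gram_independent_imp_sq_dist[where p = p and u = u and w = w and d = d])
          (fact nz, fact indep, fact stress)
    qed (auto simp: fin polynomial_on_sq_dist_fun polynomial_on_sq_dist_grad has_gradient_sq_dist_fun)
  next
    assume dense: "poly_dense E (range (\<lambda>x e. sq_dist_fun d (u e) (w e) x))"
    obtain q where indep: "\<And>\<omega>. (\<And>c. c \<in> ?I d \<Longrightarrow>
        (\<Sum>e\<in>E. \<omega> e * sq_dist_grad (u e) (w e) c q) = 0) \<Longrightarrow> \<forall>e\<in>E. \<omega> e = 0"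
    proof (rule poly_dense_imp_jacobian[where E = E and I = "?I d"
          and f = "\<lambda>e. sq_dist_fun d (u e) (w e)"
          and f' = "\<lambda>e. sq_dist_grad (u e) (w e)" and h = "\<lambda>_. 1" and z = "\<lambda>_. 0"])
      fix q assume "\<And>\<omega>. (\<And>c. c \<in> ?I d \<Longrightarrow>
        (\<Sum>e\<in>E. \<omega> e * sq_dist_grad (u e) (w e) c q) = 0) \<Longrightarrow> \<forall>e\<in>E. \<omega> e = 0"
      then show thesis by (rule that)
    qed (use fin dense in \<open>simp_all add: polynomial_on_sq_dist_fun has_gradient_sq_dist_fun
        polynomial_on_const\<close>)
    show "poly_dense (graph_coords E) (range (\<lambda>x c. gram_fun (Suc d) u w c x))"
    proof (rule jacobian_imp_poly_dense[where I = "?I (Suc d)" and f' = "gram_grad u w"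
          and \<xi> = "\<lambda>(k, i). if k < d then q (k, i) else 1"])
      fix \<omega> assume stress: "\<And>c. c \<in> ?I (Suc d) \<Longrightarrow> (\<Sum>a\<in>graph_coords E.
        \<omega> a * gram_grad u w a c (\<lambda>(k, i). if k < d then q (k, i) else 1)) = 0"
      show "\<forall>a\<in>graph_coords E. \<omega> a = 0"
        by (rule sq_dist_independent_imp_gram[where q = q and u = u and w = w and d = d])
          (fact indep, fact stress)
    qed (use fin gram in simp_all)
  qed
qed

section \<open>Symmetric matrices of bounded rank\<close>

lemma symmetric_matrix_inner_commute:
  fixes A :: "real ^ 'v::finite ^ 'v"
  assumes "transpose A = A"
  shows "x \<bullet> (A *v y) = (A *v x) \<bullet> y"
  using assms by (metis dot_lmul_matrix transpose_matrix_vector)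

text \<open>Polarisation: if the quadratic form were zero, so would be the bilinear form, and hence
  \<open>A\<close>.\<close>

lemma symmetric_nonzero_quadratic_form:
  fixes A :: "real ^ 'v::finite ^ 'v"
  assumes "transpose A = A" "A \<noteq> 0"
  obtains x where "x \<bullet> (A *v x) \<noteq> 0"
proof -
  have False if all0: "\<And>x. x \<bullet> (A *v x) = 0"
  proof -
    have "x \<bullet> (A *v y) = 0" for x y
    proof -
      have "(x + y) \<bullet> (A *v (x + y)) = x \<bullet> (A *v x) + y \<bullet> (A *v y) + 2 * (x \<bullet> (A *v y))"
        using symmetric_matrix_inner_commute[OF assms(1), of y x]
        by (simp add: matrix_vector_right_distrib inner_add_left inner_add_right inner_commute)
      then show ?thesis using all0 by simp
    qed
    then have "A *v y = 0" for y using inner_eq_zero_iff by blast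
    then have "A = 0" by (simp add: matrix_eq)
    then show False using assms(2) by simp
  qed
  then show ?thesis using that by blast
qed

text \<open>Splitting off \<open>A x x\<^sup>T A / (x\<^sup>T A x)\<close> lowers the rank of a symmetric matrix by one.\<close>

lemma symmetric_rank_decomposition:
  fixes A :: "real ^ 'v::finite ^ 'v"
  assumes "transpose A = A" "rank A \<le> n"
  shows "\<exists>d v. \<forall>i j. A $ i $ j = (\<Sum>k<n. d k * (v k i * v k j))"
  using assms
proof (induction n arbitrary: A)
  case 0
  then have "A = 0" using rank_eq_0 by auto
  then show ?case by simp
next
  case (Suc n)
  show ?case
  proof (cases "A = 0")
    case True
    then show ?thesis by (intro exI[of _ "\<lambda>_. 0"]) simp
  next
    case False
    obtain x where x: "x \<bullet> (A *v x) \<noteq> 0"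
      using symmetric_nonzero_quadratic_form[OF Suc.prems(1) False] .
    define y where "y = A *v x"
    define c where "c = x \<bullet> y"
    have c: "c \<noteq> 0" using x by (simp add: c_def y_def)
    define B :: "real ^ 'v ^ 'v" where "B = (\<chi> i j. A $ i $ j - y $ i * y $ j / c)"
    have sym: "A $ i $ j = A $ j $ i" for i j
      using Suc.prems(1) by (metis transpose_def vec_lambda_beta)
    have "transpose B = B" by (simp add: vec_eq_iff transpose_def B_def sym mult.commute)
    moreover have "rank B \<le> n"
    proof -
      have Bz: "B *v z = A *v z - ((y \<bullet> z) / c) *\<^sub>R y" for z
        by (simp add: vec_eq_iff B_def matrix_vector_mult_def left_diff_distrib sum_subtractf
            inner_vec_def sum_distrib_right sum_divide_distrib mult.commute mult.left_commute
            sum_distrib_left right_diff_distrib)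
      have "B *v z = A *v (z - ((y \<bullet> z) / c) *\<^sub>R x)" for z
        unfolding Bz y_def by (simp add: matrix_vector_mult_diff_distrib matrix_vector_mult_scaleR)
      then have sub: "range ((*v) B) \<subseteq> range ((*v) A)" by auto
      have "x \<bullet> (B *v z) = 0" for z
        unfolding Bz using symmetric_matrix_inner_commute[OF Suc.prems(1), of x z] c
        by (simp add: inner_diff_right flip: y_def c_def)
      \<comment> \<open>The range of \<open>B\<close> is orthogonal to \<open>x\<close>, while
        \<open>x \<bullet> y = c\<close> is nonzero; so \<open>y\<close> is lost from the range and
        its dimension drops.\<close>
      then have "y \<notin> range ((*v) B)" using c unfolding c_def by auto
      moreover have "y \<in> range ((*v) A)" by (simp add: y_def)
      ultimately have "range ((*v) B) \<subset> range ((*v) A)" using sub by blast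
      moreover have "subspace (range ((*v) B))" "subspace (range ((*v) A))"
        by (intro linear_subspace_image matrix_vector_mul_linear subspace_UNIV)+
      ultimately have "dim (range ((*v) B)) < dim (range ((*v) A))"
        by (intro dim_psubset) (simp only: span_eq_iff[THEN iffD2])
      then show ?thesis using Suc.prems(2) by (simp add: rank_dim_range)
    qed
    ultimately obtain d v where dv: "\<forall>i j. B $ i $ j = (\<Sum>k<n. d k * (v k i * v k j))"
      using Suc.IH by blast
    have "A $ i $ j = B $ i $ j + 1 / c * (y $ i * y $ j)" for i j by (simp add: B_def)
    then show ?thesis using dv
      by (intro exI[of _ "d(n := 1 / c)"] exI[of _ "v(n := (\<lambda>i. y $ i))"]) simp
  qed
qed

text \<open>The range of the Gram matrix is spanned by the \<open>n\<close> rows of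
  \<open>x\<close>.\<close>

lemma gram_matrix_sym_rank_le:
  fixes x :: "nat \<times> 'v::finite \<Rightarrow> real"
  shows "(\<chi> i j. inner_fun n i j x) \<in> sym_rank_le n"
proof -
  let ?A = "\<chi> i j. inner_fun n i j x" and ?v = "\<lambda>k. \<chi> i. x (k, i)"
  have "?A *v z = (\<Sum>k<n. (?v k \<bullet> z) *\<^sub>R ?v k)" for z
    by (simp add: vec_eq_iff matrix_vector_mult_def inner_fun_def inner_vec_def sum_distrib_right)
      (subst sum.swap, simp add: mult_ac)
  then have "range ((*v) ?A) \<subseteq> span (?v ` {..<n})"
    by (auto intro!: span_sum span_scale intro: span_base)
  then have "dim (range ((*v) ?A)) \<le> card (?v ` {..<n})" by (rule dim_le_card) simp
  also have "\<dots> \<le> n" using card_image_le[of "{..<n}" ?v] by simp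
  finally have "rank ?A \<le> n" by (simp add: rank_dim_range)
  moreover have "transpose ?A = ?A"
    by (simp add: vec_eq_iff transpose_def inner_fun_def mult.commute)
  ultimately show ?thesis by (simp add: sym_rank_le_def)
qed

section \<open>Density of the graph projection\<close>

lemma graph_proj_eq:
  assumes "transpose A = A" "\<And>e. e \<in> E \<Longrightarrow> e = {u e, w e}" "c \<in> graph_coords E"
  shows "graph_proj E A c = (case c of Inl i \<Rightarrow> A $ i $ i | Inr e \<Rightarrow> A $ u e $ w e)"
proof -
  have sym: "A $ i $ j = A $ j $ i" for i j
    using assms(1) by (metis transpose_def vec_lambda_beta)
  have "on_edge (\<lambda>i j. A $ i $ j) e = A $ u e $ w e" if "e \<in> E" for e
    using on_edge_doubleton[of "\<lambda>i j. A $ i $ j" "u e" "w e"] sym assms(2)[OF that] by metis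
  then show ?thesis using assms(3) by (auto simp: graph_proj_def graph_coords_def)
qed

text \<open>A matrix of rank at most \<open>n\<close> is \<open>\<Sum>k<n. d k * v k v k\<^sup>T\<close>. On the line from \<open>\<Sum>k<n. v k v k\<^sup>T\<close> to
  it, the points close to the start have positive coefficients and hence are Gram matrices.\<close>

lemma poly_dense_graph_proj_iff_gram:
  fixes E :: "'v::finite set set"
  assumes E: "\<And>e. e \<in> E \<Longrightarrow> e = {u e, w e}"
  shows "poly_dense (graph_coords E) (graph_proj E ` sym_rank_le n) \<longleftrightarrow>
    poly_dense (graph_coords E) (range (\<lambda>x c. gram_fun n u w c x))"
proof
  assume "poly_dense (graph_coords E) (range (\<lambda>x c. gram_fun n u w c x))"
  then show "poly_dense (graph_coords E) (graph_proj E ` sym_rank_le n)"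
  proof (rule poly_dense_cong)
    fix y assume "y \<in> range (\<lambda>x c. gram_fun n u w c x)"
    then obtain x where y: "y = (\<lambda>c. gram_fun n u w c x)" by auto
    let ?A = "\<chi> i j. inner_fun n i j x"
    have A: "?A \<in> sym_rank_le n" by (rule gram_matrix_sym_rank_le)
    then have "transpose ?A = ?A" by (simp add: sym_rank_le_def)
    from graph_proj_eq[where u = u and w = w and E = E, OF this E]
    have "\<forall>c\<in>graph_coords E. y c = graph_proj E ?A c"
      unfolding y by (auto simp: gram_fun_def split: sum.split)
    then show "\<exists>z\<in>graph_proj E ` sym_rank_le n. \<forall>c\<in>graph_coords E. y c = z c" using A by blast
  qed
next
  assume dense: "poly_dense (graph_coords E) (graph_proj E ` sym_rank_le n)"
  show "poly_dense (graph_coords E) (range (\<lambda>x c. gram_fun n u w c x))"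
    unfolding poly_dense_def
  proof (intro allI impI)
    fix F y assume F: "polynomial_on (graph_coords E) F"
      and F0: "\<forall>y\<in>range (\<lambda>x c. gram_fun n u w c x). F y = 0"
    show "F y = 0"
    proof (rule poly_denseD[OF dense F])
      fix z assume "z \<in> graph_proj E ` sym_rank_le n"
      then obtain A where z: "z = graph_proj E A" and A: "transpose A = A" "rank A \<le> n"
        by (auto simp: sym_rank_le_def)
      obtain d v where dv: "\<And>i j. A $ i $ j = (\<Sum>k<n. d k * (v k i * v k j))"
        using symmetric_rank_decomposition[OF A] by blast
      define a b where "a = case_sum (\<lambda>i. i) u" and "b = case_sum (\<lambda>i. i) w"
      \<comment> \<open>On this line \<open>l 0\<close> has all coefficients 1, and
        \<open>l 1\<close> has those of \<open>A\<close>.\<close>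
      define l where "l t c = (\<Sum>k<n. v k (a c) * v k (b c)) +
        t * (\<Sum>k<n. (d k - 1) * (v k (a c) * v k (b c)))" for t c
      have l_eq: "l t c = (\<Sum>k<n. (1 + t * (d k - 1)) * (v k (a c) * v k (b c)))" for t c
        unfolding l_def sum_distrib_left sum.distrib[symmetric]
        by (rule sum.cong) (auto simp: algebra_simps)
      obtain p where p: "\<And>t. F (l t) = poly p t"
        using polynomial_on_line[OF F, of "\<lambda>c. \<Sum>k<n. v k (a c) * v k (b c)"
            "\<lambda>c. \<Sum>k<n. (d k - 1) * (v k (a c) * v k (b c))"] unfolding l_def by blast
      \<comment> \<open>For 0 < t < 1 / M each \<open>t * (d k - 1)\<close> has absolute value at
        most 1, so the coefficients are nonnegative and have square roots. The summand 1 keeps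
        \<open>M\<close> positive.\<close>
      define M where "M = 1 + (\<Sum>k<n. \<bar>d k - 1\<bar>)"
      have "M \<ge> 1" unfolding M_def by (simp add: sum_nonneg)
      have "poly p t = 0" if t: "t \<in> {0<..<1 / M}" for t
      proof -
        have pos: "0 \<le> 1 + t * (d k - 1)" if "k < n" for k
        proof -
          have "\<bar>d k - 1\<bar> \<le> (\<Sum>k<n. \<bar>d k - 1\<bar>)" using that by (intro member_le_sum) auto
          then have "t * \<bar>d k - 1\<bar> \<le> t * M" using t by (intro mult_left_mono) (auto simp: M_def)
          also have "\<dots> \<le> 1" using t \<open>M \<ge> 1\<close> by (simp add: field_simps)
          finally have "\<bar>t * (d k - 1)\<bar> \<le> 1" using t by (simp add: abs_mult)
          then show ?thesis by linarith
        qed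
        define x where "x = (\<lambda>(k, i). sqrt (1 + t * (d k - 1)) * v k i)"
        have "l t c = gram_fun n u w c x" for c
        proof -
          have "gram_fun n u w c x = inner_fun n (a c) (b c) x"
            by (auto simp: gram_fun_def a_def b_def split: sum.split)
          also have "\<dots> = l t c"
            unfolding inner_fun_def l_eq
          proof (rule sum.cong)
            fix k assume "k \<in> {..<n}"
            then have "sqrt (1 + t * (d k - 1)) * sqrt (1 + t * (d k - 1)) = 1 + t * (d k - 1)"
              using pos by simp
            then show "x (k, a c) * x (k, b c) = (1 + t * (d k - 1)) * (v k (a c) * v k (b c))"
              unfolding x_def by (simp add: mult.assoc mult.left_commute flip: mult.assoc[of "sqrt _"])
          qed simp
          finally show ?thesis by simp
        qed
        then have "l t = (\<lambda>c. gram_fun n u w c x)" by blast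
        then show ?thesis using F0 p[of t] by auto
      qed
      \<comment> \<open>Infinitely many zeros make \<open>p\<close> the zero polynomial, and at
        \<open>t = 1\<close> this reaches the given matrix.\<close>
      then have "{0<..<1 / M} \<subseteq> {t. poly p t = 0}" by blast
      moreover have "infinite {0<..<1 / M}" using \<open>M \<ge> 1\<close> by (intro infinite_Ioo) simp
      ultimately have "p = 0" using poly_roots_finite finite_subset by blast
      then have "F (l 1) = 0" using p[of 1] by simp
      moreover have "F z = F (l 1)"
      proof (rule polynomial_on_cong[OF F])
        fix c assume "c \<in> graph_coords E"
        then show "z c = l 1 c"
          unfolding z l_eq using graph_proj_eq[where u = u and w = w and E = E, OF A(1) E]
          by (auto simp: dv a_def b_def split: sum.split)
      qed
      ultimately show "F z = 0" by simp
    qed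
  qed
qed

section \<open>From density to the rigidity matroid\<close>

lemma complete_edges_endpoints:
  assumes "E \<subseteq> complete_edges"
  shows "\<exists>u w. \<forall>e\<in>E. e = {u e, w e} \<and> u e \<noteq> w e"
proof -
  have "\<forall>e\<in>E. \<exists>p. e = {fst p, snd p} \<and> fst p \<noteq> snd p"
  proof
    fix e assume "e \<in> E"
    then obtain i j where "e = {i, j}" "i \<noteq> j" using assms by (auto simp: complete_edges_def card_2_iff)
    then show "\<exists>p. e = {fst p, snd p} \<and> fst p \<noteq> snd p" by (intro exI[of _ "(i, j)"]) simp
  qed
  from bchoice[OF this] obtain p where "\<forall>e\<in>E. e = {fst (p e), snd (p e)} \<and> fst (p e) \<noteq> snd (p e)" ..
  then show ?thesis by (intro exI[of _ "\<lambda>e. fst (p e)"] exI[of _ "\<lambda>e. snd (p e)"])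
qed

lemma reval_sq_dist_poly: "reval x (sq_dist_poly d i j) = sq_dist_fun d i j x"
  by (simp add: sq_dist_poly_def sq_dist_fun_def reval_sum reval_power reval_diff reval_rVar)

lemma sq_dist_poly_commute: "sq_dist_poly d i j = sq_dist_poly d j i"
  unfolding sq_dist_poly_def by (simp add: power2_commute)

lemma poly_dense_graph_proj_Suc_iff:
  fixes E :: "'v::finite set set"
  assumes "E \<subseteq> complete_edges"
  shows "poly_dense (graph_coords E) (graph_proj E ` sym_rank_le (Suc d)) \<longleftrightarrow>
    E \<in> rigidity_indep_sets (int d)"
proof -
  from complete_edges_endpoints[OF assms] obtain u w where
    "\<forall>e\<in>E. e = {u e, w e} \<and> u e \<noteq> w e" by (elim exE) (rule that)
  then have E: "e = {u e, w e}" if "e \<in> E" for e using that by simp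
  have eq: "reval x (on_edge (sq_dist_poly d) e) = sq_dist_fun d (u e) (w e) x" if "e \<in> E" for e x
  proof -
    have "on_edge (sq_dist_poly d) e = sq_dist_poly d (u e) (w e)"
      using on_edge_doubleton[of "sq_dist_poly d" "u e" "w e"] sq_dist_poly_commute E[OF that]
      by metis
    then show ?thesis by (simp add: reval_sq_dist_poly)
  qed
  have agree: "\<forall>e\<in>E. sq_dist_fun d (u e) (w e) x = reval x (on_edge (sq_dist_poly d) e)" for x
    using eq by simp
  have "poly_dense (graph_coords E) (graph_proj E ` sym_rank_le (Suc d)) \<longleftrightarrow>
      poly_dense (graph_coords E) (range (\<lambda>x c. gram_fun (Suc d) u w c x))"
    by (rule poly_dense_graph_proj_iff_gram) (fact E)
  also have "\<dots> \<longleftrightarrow> poly_dense E (range (\<lambda>x e. sq_dist_fun d (u e) (w e) x))"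
    by (rule poly_dense_gram_iff_sq_dist)
  also have "\<dots> \<longleftrightarrow> poly_dense E (range (\<lambda>x e. reval x (on_edge (sq_dist_poly d) e)))"
  proof
    assume "poly_dense E (range (\<lambda>x e. sq_dist_fun d (u e) (w e) x))"
    then show "poly_dense E (range (\<lambda>x e. reval x (on_edge (sq_dist_poly d) e)))"
      by (rule poly_dense_cong) (use agree in auto)
  next
    assume "poly_dense E (range (\<lambda>x e. reval x (on_edge (sq_dist_poly d) e)))"
    then show "poly_dense E (range (\<lambda>x e. sq_dist_fun d (u e) (w e) x))"
      by (rule poly_dense_cong) (use agree in fastforce)
  qed
  also have "\<dots> \<longleftrightarrow> alg_independent E (on_edge (sq_dist_poly d))"
    by (rule alg_independent_iff_poly_dense[symmetric]) simp
  finally show ?thesis using assms by (simp add: rigidity_indep_sets_def)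
qed

text \<open>Types are nonempty, so there is a vertex, and its diagonal coordinate vanishes on the
  projection of the zero matrix. This rules out the rank 0.\<close>

lemma not_poly_dense_graph_proj_0:
  fixes E :: "'v::finite set set"
  shows "\<not> poly_dense (graph_coords E) (graph_proj E ` sym_rank_le 0)"
proof
  fix i :: 'v
  assume dense: "poly_dense (graph_coords E) (graph_proj E ` sym_rank_le 0)"
  have "(\<lambda>_. 1 :: real) (Inl i :: 'v + 'v set) = 0"
  proof (rule poly_denseD[OF dense, where F = "\<lambda>y. y (Inl i)"])
    show "polynomial_on (graph_coords E) (\<lambda>y. y (Inl i))"
      by (rule polynomial_on_var) (auto simp: graph_coords_def)
    fix y assume "y \<in> graph_proj E ` sym_rank_le 0"
    then show "y (Inl i) = 0"
      by (auto simp: sym_rank_le_def rank_eq_0 graph_proj_def graph_coords_def)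
  qed
  then show False by simp
qed

text \<open>At \<open>CARD('v)\<close> the rank bound is void, and every assignment of graph
  coordinates extends to a symmetric matrix. Hence the minimum that defines
  \<open>graph_rank\<close> is attained.\<close>

lemma poly_dense_graph_proj_card:
  fixes E :: "'v::finite set set"
  assumes "E \<subseteq> complete_edges"
  shows "poly_dense (graph_coords E) (graph_proj E ` sym_rank_le CARD('v))"
  unfolding poly_dense_def
proof (intro allI impI)
  fix F and y :: "'v + 'v set \<Rightarrow> real"
  assume F: "polynomial_on (graph_coords E) F" "\<forall>z\<in>graph_proj E ` sym_rank_le CARD('v). F z = 0"
  from complete_edges_endpoints[OF assms] obtain u w where
    "\<forall>e\<in>E. e = {u e, w e} \<and> u e \<noteq> w e" by (elim exE) (rule that)
  then have E: "e = {u e, w e}" "u e \<noteq> w e" if "e \<in> E" for e using that by simp_all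
  define A :: "real ^ 'v ^ 'v" where "A = (\<chi> i j. if i = j then y (Inl i) else y (Inr {i, j}))"
  have sym: "transpose A = A" by (auto simp: vec_eq_iff transpose_def A_def insert_commute)
  moreover have "rank A \<le> CARD('v)" using rank_bound[of A] by simp
  ultimately have "F (graph_proj E A) = 0" using F(2) by (auto simp: sym_rank_le_def)
  moreover have "F y = F (graph_proj E A)"
  proof (rule polynomial_on_cong[OF F(1)])
    fix c assume c: "c \<in> graph_coords E"
    have "graph_proj E A c = (case c of Inl i \<Rightarrow> A $ i $ i | Inr e \<Rightarrow> A $ u e $ w e)"
      by (rule graph_proj_eq) (fact sym, fact E(1), fact c)
    also have "\<dots> = y c"
    proof (cases c)
      case (Inr e)
      then have "e \<in> E" using c by (auto simp: graph_coords_def)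
      then show ?thesis using Inr E(2)[of e] E(1)[of e, symmetric] by (simp add: A_def)
    qed (simp add: A_def)
    finally show "y c = graph_proj E A c" by simp
  qed
  ultimately show "F y = 0" by simp
qed

theorem theorem2p6:
  fixes E :: "'v::finite set set" and n :: nat
  assumes "E \<subseteq> complete_edges"
  shows "graph_rank E = n \<longleftrightarrow>
    E \<in> rigidity_indep_sets (int n - 1) \<and> E \<notin> rigidity_indep_sets (int n - 2)"
proof -
  define P where "P k \<longleftrightarrow> poly_dense (graph_coords E) (graph_proj E ` sym_rank_le k)" for k
  have "finite (graph_coords E)" "graph_coords E \<noteq> {}"
    "card (graph_coords E) = CARD('v) + card E"
    by (auto simp: graph_coords_def card_Plus)
  moreover have "graph_proj E ` sym_rank_le k \<subseteq> graph_coords E \<rightarrow>\<^sub>E UNIV" for k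
    by (auto simp: graph_proj_def)
  ultimately have rank: "graph_rank E = (LEAST k. P k)"
    unfolding graph_rank_def P_def using zariski_dim_eq_card_iff_poly_dense by metis
  have mono: "P k \<Longrightarrow> k \<le> k' \<Longrightarrow> P k'" for k k'
    unfolding P_def by (erule poly_dense_mono) (auto simp: sym_rank_le_def)
  have P_Suc: "P (Suc d) \<longleftrightarrow> E \<in> rigidity_indep_sets (int d)" for d
    unfolding P_def by (rule poly_dense_graph_proj_Suc_iff[OF assms])
  have "\<not> P 0" unfolding P_def by (rule not_poly_dense_graph_proj_0)
  have "P CARD('v)" unfolding P_def by (rule poly_dense_graph_proj_card[OF assms])
  then have "P (LEAST k. P k)" by (rule LeastI)
  then have least: "(LEAST k. P k) = n \<longleftrightarrow> P n \<and> (\<forall>k<n. \<not> P k)"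
    using not_less_Least[of _ P] Least_equality[of P n] by (metis not_le)
  have neg: "E \<notin> rigidity_indep_sets k" if "k < 0" for k
    using that by (simp add: rigidity_indep_sets_def)
  show ?thesis
  proof (cases n)
    case 0
    then show ?thesis unfolding rank least using \<open>\<not> P 0\<close> neg by simp
  next
    case (Suc d)
    \<comment> \<open>By monotonicity, failure below \<open>n\<close> is decided at the immediate
      predecessor.\<close>
    then have "(\<forall>k<n. \<not> P k) \<longleftrightarrow> \<not> P d" using mono less_Suc_eq_le by auto
    \<comment> \<open>For \<open>d = 0\<close> the index is -1 and both sides are false: rank 0
      never gives density, and no set is independent at a negative index.\<close>
    moreover have "P d \<longleftrightarrow> E \<in> rigidity_indep_sets (int d - 1)"
    proof (cases d)
      case 0
      then show ?thesis using \<open>\<not> P 0\<close> neg by simp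
    next
      case (Suc d')
      then show ?thesis using P_Suc[of d'] by simp
    qed
    ultimately show ?thesis unfolding rank least using Suc P_Suc[of d] by simp
  qed
qed

end
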